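(* Let $q$ be a complex number with $0<|q|<1$. Then the following five identities hold: \begin{align*} \sum_{i,j,k\ge 0}\frac{q^{2i^2+2j^2+4k^2+2ij+4ik+4jk-2i+2k}}{(q^2;q^2)_i(q^2;q^2)_j(q^4;q^4)_k} &=2\,\frac{(q^8;q^8)_\infty}{(q^2;q^2)_\infty},\\ \sum_{i,j,k\ge 0}\frac{q^{2i^2+2j^2+4k^2+2ij+4ik+4jk-j}}{(q^2;q^2)_i(q^2;q^2)_j(q^4;q^4)_k} &=\frac{1}{(q,q^4,q^7;q^8)_\infty},\\ \sum_{i,j,k\ge 0}\frac{q^{2i^2+2j^2+4k^2+2ij+4ik+4jk+2k}}{(q^2;q^2)_i(q^2;q^2)_j(q^4;q^4)_k} &=\frac{(q^4;q^4)^3_\infty}{(q^2;q^2)_\infty^2(q^8;q^8)_\infty},\\ \sum_{i,j,k\ge 0}\frac{q^{2i^2+2j^2+4k^2+2ij+4ik+4jk+2i+2k}}{(q^2;q^2)_i(q^2;q^2)_j(q^4;q^4)_k} &=\frac{(q^8;q^8)_\infty}{(q^2;q^2)_\infty},\\ \sum_{i,j,k\ge 0}\frac{q^{2i^2+2j^2+4k^2+2ij+4ik+4jk+2i+j+4k}}{(q^2;q^2)_i(q^2;q^2)_j(q^4;q^4)_k} &=\frac{1}{(q^3,q^4,q^5;q^8)_\infty}. \end{align*}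
   Context: For $|q|<1$: $(a;q)_\infty=\prod_{m=0}^\infty(1-aq^m)$, $(a;q)_n=(a;q)_\infty/(aq^n;q)_\infty=\prod_{m=0}^{n-1}(1-aq^m)$ for integers $n\ge0$, and $(a_1,\dots,a_r;q)_\infty=(a_1;q)_\infty\cdots(a_r;q)_\infty$; the same notation is used with the base $q$ replaced by a power of $q$. *)

theory Defs
  imports "HOL-Analysis.Analysis"
begin

text \<open>The q-Pochhammer symbols. The infinite product uses the library's \<^const>\<open>prodinf\<close>,
  which converges for \<open>norm q < 1\<close> and also gives the value 0 when finitely many factors vanish.\<close>

definition qpoch_inf :: "complex \<Rightarrow> complex \<Rightarrow> complex" where
  "qpoch_inf a q = (\<Prod>m. 1 - a * q ^ m)"

definition qpoch :: "complex \<Rightarrow> complex \<Rightarrow> nat \<Rightarrow> complex" where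
  "qpoch a q n = (\<Prod>m<n. 1 - a * q ^ m)"

definition qpoch_inf_list :: "complex list \<Rightarrow> complex \<Rightarrow> complex" where
  "qpoch_inf_list as q = prod_list (map (\<lambda>a. qpoch_inf a q) as)"

end

theory Submission
  imports Defs
begin

text \<open>
  The quadratic form in the exponents is \<open>(i + j + 2k)^2 + i^2 + j^2\<close>. Grouping the triples
  by \<open>N = i + j + 2k\<close> therefore turns each triple sum into \<open>\<Sum>N. q^(N^2) b^N c\<^sub>N\<close>, where
  \<open>c\<^sub>N\<close> is the coefficient of \<open>z^N\<close> in a product of three Euler series in \<open>z\<close> with the product form
  \<open>(-e z; q^2) (-z; q^2) / (z^2; q^4) = (-e z; q^2) / (z; q^2)\<close>
  (all infinite products). In each of the five linear terms the powers of \<open>b\<close> and \<open>e\<close> can be chosen so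
  that one numerator factor cancels half of the denominator in this way, and the q-binomial theorem
  gives \<open>c\<^sub>N = (-e; q^2)\<^sub>N / (q^2; q^2)\<^sub>N\<close>. The coefficient extraction is
  \<^emph>\<open>finite_triple_convolution\<close>, the regrouping is \<^emph>\<open>triple_sum_eq_single_sum\<close>.

  What remains are classical single sums. For \<open>b = q\<close> and \<open>e = q^(-2), 1, q^2\<close> they are instances of
  Lebesgue's identity in base \<open>q^2\<close>; for \<open>e = q\<close> and \<open>b = 1, q^2\<close> they are the two
  Goellnitz-Gordon sums.

  Lebesgue's identity is proved by a telescoping q-difference equation in its parameter, which
  reduces it to Euler's series. For the Goellnitz-Gordon identities, both the series and a theta-like
  series divided by infinite products satisfy the same second-order q-difference equation in
  \<open>x = q^(2m)\<close> and tend to 1 as \<open>m\<close> grows, so they agree; at \<open>m = 0\<close> and \<open>m = 1\<close> the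
  theta-like series becomes a true theta series, which the Jacobi triple product evaluates.
  Euler's series and the triple product are both limits of one finite identity, Rothe's form of the
  q-binomial theorem.
\<close>

section \<open>Finite and infinite q-Pochhammer symbols\<close>

lemma qpoch_0 [simp]: "qpoch a p 0 = 1"
  by (simp add: qpoch_def)

lemma qpoch_Suc: "qpoch a p (Suc n) = qpoch a p n * (1 - a * p ^ n)"
  by (simp add: qpoch_def)

lemma qpoch_add: "qpoch a p (m + n) = qpoch a p m * qpoch (a * p ^ m) p n"
  by (induction n) (simp_all add: qpoch_Suc power_add mult_ac)

lemma qpoch_Suc': "qpoch a p (Suc n) = (1 - a) * qpoch (a * p) p n"
  using qpoch_add[of a p 1 n] by (simp add: qpoch_Suc)

lemma norm_mult_power_less_1:
  fixes a p :: complex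
  assumes "norm a < 1" "norm p < 1"
  shows "norm (a * p ^ n) < 1"
proof -
  have "norm (a * p ^ n) \<le> norm a * 1"
    unfolding norm_mult norm_power using assms by (intro mult_left_mono power_le_one) auto
  with assms show ?thesis by simp
qed

lemma one_minus_mult_power_nonzero:
  fixes a p :: complex
  assumes "norm a < 1" "norm p < 1"
  shows "1 - a * p ^ n \<noteq> 0"
  using norm_mult_power_less_1[OF assms, of n] by (metis eq_iff_diff_eq_0 norm_one order_less_irrefl)

lemma one_minus_power_nonzero:
  fixes p :: complex
  assumes "norm p < 1" "n > 0"
  shows "1 - p ^ n \<noteq> 0"
proof -
  have "norm (p ^ n) < 1"
    using assms by (simp add: norm_power power_less_one_iff)
  then show ?thesis by auto
qed

lemma qpoch_nonzero:
  assumes "norm a < 1" "norm p < 1"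
  shows "qpoch a p n \<noteq> 0"
  unfolding qpoch_def using one_minus_mult_power_nonzero[OF assms] by simp

lemma convergent_prod_qpoch:
  fixes a p :: complex
  assumes "norm p < 1"
  shows "convergent_prod (\<lambda>m. 1 - a * p ^ m)"
proof -
  have "summable (\<lambda>i. norm a * norm p ^ i)"
    using assms by (intro summable_mult summable_geometric) simp
  then have "summable (\<lambda>i. norm (1 - a * p ^ i - 1))"
    by (simp add: norm_mult norm_power del: summable_cmult_iff)
  then show ?thesis
    by (intro abs_convergent_prod_imp_convergent_prod summable_imp_abs_convergent_prod)
qed

lemma qpoch_tendsto:
  assumes "norm p < 1"
  shows "qpoch a p \<longlonglongrightarrow> qpoch_inf a p"
proof -
  have "(\<lambda>n. qpoch a p (Suc n)) \<longlonglongrightarrow> qpoch_inf a p"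
    using convergent_prod_LIMSEQ[OF convergent_prod_qpoch[OF assms]]
    unfolding qpoch_def qpoch_inf_def lessThan_Suc_atMost .
  then show ?thesis by (rule LIMSEQ_imp_Suc)
qed

lemma qpoch_inf_nonzero:
  assumes "norm a < 1" "norm p < 1"
  shows "qpoch_inf a p \<noteq> 0"
  unfolding qpoch_inf_def
  by (rule prodinf_nonzero[OF convergent_prod_qpoch[OF assms(2)]])
     (rule one_minus_mult_power_nonzero[OF assms])

lemma qpoch_inf_split:
  assumes "norm p < 1"
  shows "qpoch_inf a p = qpoch a p n * qpoch_inf (a * p ^ n) p"
proof (rule LIMSEQ_unique)
  show "(\<lambda>m. qpoch a p (n + m)) \<longlonglongrightarrow> qpoch_inf a p"
    using LIMSEQ_ignore_initial_segment[OF qpoch_tendsto[OF assms, of a], of n]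
    by (simp add: add.commute)
  show "(\<lambda>m. qpoch a p (n + m)) \<longlonglongrightarrow> qpoch a p n * qpoch_inf (a * p ^ n) p"
    unfolding qpoch_add by (intro tendsto_intros qpoch_tendsto assms)
qed

lemma qpoch_inf_rec:
  assumes "norm p < 1"
  shows "qpoch_inf a p = (1 - a) * qpoch_inf (a * p) p"
  using qpoch_inf_split[OF assms, of a 1] by (simp add: qpoch_Suc)

lemma qpoch_inf_power_tendsto_1:
  assumes "norm a < 1" "norm p < 1"
  shows "(\<lambda>n. qpoch_inf (a * p ^ n) p) \<longlonglongrightarrow> 1"
proof -
  note nz = qpoch_nonzero[OF assms] qpoch_inf_nonzero[OF assms]
  have "(\<lambda>n. qpoch_inf a p / qpoch a p n) \<longlonglongrightarrow> qpoch_inf a p / qpoch_inf a p"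
    by (intro tendsto_intros qpoch_tendsto assms nz)
  also have "(\<lambda>n. qpoch_inf a p / qpoch a p n) = (\<lambda>n. qpoch_inf (a * p ^ n) p)"
    using nz by (simp add: fun_eq_iff qpoch_inf_split[OF assms(2), of a] field_simps)
  finally show ?thesis using nz by simp
qed

text \<open>The dominated-convergence arguments below need uniform bounds for finite q-Pochhammer symbols and
  their reciprocals, which are obtained from convergence.\<close>

lemma convergent_imp_norm_bounded:
  fixes f :: "nat \<Rightarrow> complex"
  assumes "f \<longlonglongrightarrow> l"
  obtains C where "C > 0" "\<And>n. norm (f n) \<le> C"
proof -
  from assms have "Bseq f" by (intro convergent_imp_Bseq) (auto simp: convergent_def)
  then show ?thesis using that by (auto simp: Bseq_def)
qed

lemma qpoch_bounded:
  assumes "norm p < 1"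
  obtains C where "C > 0" "\<And>n. norm (qpoch a p n) \<le> C"
  using convergent_imp_norm_bounded[OF qpoch_tendsto[OF assms, of a]] that by metis

lemma inverse_qpoch_bounded:
  assumes "norm a < 1" "norm p < 1"
  obtains C where "C > 0" "\<And>n. norm (inverse (qpoch a p n)) \<le> C"
  using convergent_imp_norm_bounded[OF tendsto_inverse[OF qpoch_tendsto[OF assms(2), of a]
        qpoch_inf_nonzero[OF assms]]] that by metis

lemma qpoch_inf_even_odd:
  assumes "norm p < 1"
  shows "qpoch_inf a p = qpoch_inf a (p ^ 2) * qpoch_inf (a * p) (p ^ 2)"
proof (rule LIMSEQ_unique)
  have p2: "norm (p ^ 2) < 1"
    using assms by (simp add: norm_power power_less_one_iff)
  have "filterlim (\<lambda>n::nat. 2 * n) at_top at_top"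
    by (intro filterlim_subseq strict_monoI) auto
  from filterlim_compose[OF qpoch_tendsto[OF assms] this]
  show "(\<lambda>n. qpoch a p (2 * n)) \<longlonglongrightarrow> qpoch_inf a p" .
  have "qpoch a p (2 * n) = qpoch a (p ^ 2) n * qpoch (a * p) (p ^ 2) n" for n
    by (induction n) (simp_all add: qpoch_Suc mult_ac flip: power_mult)
  then show "(\<lambda>n. qpoch a p (2 * n)) \<longlonglongrightarrow> qpoch_inf a (p ^ 2) * qpoch_inf (a * p) (p ^ 2)"
    by (simp only:) (intro tendsto_intros qpoch_tendsto p2)
qed

lemma qpoch_inf_mult_minus:
  assumes "norm p < 1"
  shows "qpoch_inf a p * qpoch_inf (- a) p = qpoch_inf (a ^ 2) (p ^ 2)"
proof (rule LIMSEQ_unique)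
  have p2: "norm (p ^ 2) < 1"
    using assms by (simp add: norm_power power_less_one_iff)
  show "qpoch (a ^ 2) (p ^ 2) \<longlonglongrightarrow> qpoch_inf (a ^ 2) (p ^ 2)"
    by (rule qpoch_tendsto[OF p2])
  have "qpoch (a ^ 2) (p ^ 2) n = qpoch a p n * qpoch (- a) p n" for n
    by (induction n) (simp_all add: qpoch_Suc algebra_simps power2_eq_square power_mult_distrib)
  then have "qpoch (a ^ 2) (p ^ 2) = (\<lambda>n. qpoch a p n * qpoch (- a) p n)"
    by (simp add: fun_eq_iff)
  then show "qpoch (a ^ 2) (p ^ 2) \<longlonglongrightarrow> qpoch_inf a p * qpoch_inf (- a) p"
    by (simp only:) (intro tendsto_intros qpoch_tendsto assms)
qed

section \<open>The finite q-binomial theorem\<close>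

text \<open>The left side is the coefficient of \<open>z^N\<close> in \<open>(-e z; p) / (z; p)\<close>, expanded as a product of two
  Euler series. Splitting \<open>1 - p^N = (1 - p^(N-i)) + p^(N-i) (1 - p^i)\<close> and cancelling the last factor
  of one of the two denominators shows that both sides satisfy
  \<open>(1 - p^(N+1)) u\<^sub>N\<^sub>+\<^sub>1 = (1 + e p^N) u\<^sub>N\<close>.\<close>

theorem rothe_identity:
  fixes p e :: complex
  assumes "norm p < 1"
  shows "(\<Sum>i\<le>N. e ^ i * p ^ (i choose 2) / (qpoch p p i * qpoch p p (N - i)))
           = qpoch (- e) p N / qpoch p p N"
proof (induction N)
  case 0
  show ?case by (simp add: binomial_eq_0)
next
  case (Suc N)
  note nz = qpoch_nonzero[OF assms assms] one_minus_power_nonzero[OF assms]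
  define t where "t i n = e ^ i * p ^ (i choose 2) / (qpoch p p i * qpoch p p n)" for i n
  have t1: "(1 - p ^ Suc n) * t i (Suc n) = t i n" for i n
    using nz(1)[of n] nz(1)[of "Suc n"] nz(2)[of "Suc n"] nz(1)[of i]
    unfolding t_def qpoch_Suc by (simp add: field_simps)
  have t2: "(1 - p ^ Suc i) * t (Suc i) n = e * p ^ i * t i n" for i n
    using nz(1)[of n] nz(2)[of "Suc i"] nz(1)[of i]
    unfolding t_def qpoch_Suc by (simp add: numeral_2_eq_2 field_simps power_add)
  let ?M = "Suc N"
  have "(1 - p ^ ?M) * (\<Sum>i\<le>?M. t i (?M - i))
      = (\<Sum>i\<le>?M. (1 - p ^ (?M - i)) * t i (?M - i)) + (\<Sum>i\<le>?M. p ^ (?M - i) * (1 - p ^ i) * t i (?M - i))"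
    unfolding sum_distrib_left sum.distrib[symmetric]
    by (intro sum.cong refl) (simp add: algebra_simps flip: power_add)
  also have "(\<Sum>i\<le>?M. (1 - p ^ (?M - i)) * t i (?M - i)) = (\<Sum>i\<le>N. t i (N - i))"
    by (simp, intro sum.cong refl) (simp only: Suc_diff_le atMost_iff t1 mult.assoc flip: power_Suc)
  also have "(\<Sum>i\<le>?M. p ^ (?M - i) * (1 - p ^ i) * t i (?M - i)) = (\<Sum>i\<le>N. e * p ^ N * t i (N - i))"
    unfolding sum.atMost_Suc_shift
    by (simp del: power_Suc, intro sum.cong refl)
       (simp add: t2 mult.assoc del: power_Suc, simp flip: power_add)
  also have "(\<Sum>i\<le>N. t i (N - i)) + (\<Sum>i\<le>N. e * p ^ N * t i (N - i))
       = (1 + e * p ^ N) * (qpoch (- e) p N / qpoch p p N)"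
    unfolding Suc.IH[symmetric] t_def ring_distribs sum_distrib_left by (simp add: sum.distrib)
  also have "\<dots> = (1 - p ^ ?M) * (qpoch (- e) p ?M / qpoch p p ?M)"
    using nz(1)[of N] nz(2)[of "Suc N"] by (simp add: qpoch_Suc field_simps)
  finally have "(\<Sum>i\<le>?M. t i (?M - i)) = qpoch (- e) p ?M / qpoch p p ?M"
    using nz(2)[of ?M] by (subst (asm) mult_left_cancel) auto
  then show ?case by (simp add: t_def)
qed

text \<open>The coefficient of \<open>z^n\<close> in \<open>(-z; p) / (z^2; p^2) = 1 / (z; p)\<close>; the second factor contributes even
  powers only. The same splitting of \<open>1 - p^n\<close> as for Rothe's identity gives a recurrence, now of second
  order because lowering the even index moves it by two.\<close>

lemma even_convolution:
  fixes p :: complex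
  assumes "norm p < 1"
  shows "(\<Sum>m\<le>n. (if even m then p ^ ((n - m) choose 2) / (qpoch p p (n - m) * qpoch (p ^ 2) (p ^ 2) (m div 2))
            else 0)) = 1 / qpoch p p n"
proof -
  note nz = qpoch_nonzero[OF assms assms] one_minus_power_nonzero[OF assms]
  have p2: "norm (p ^ 2) < 1"
    using assms by (simp add: norm_power power_less_one_iff)
  define c where "c m = (if even m then 1 / qpoch (p ^ 2) (p ^ 2) (m div 2) else 0)" for m
  define a where "a m = p ^ (m choose 2) / qpoch p p m" for m
  define S where "S n = (\<Sum>m\<le>n. c m * a (n - m))" for n
  have c1: "(1 - p ^ Suc (Suc m)) * c (Suc (Suc m)) = c m" for m
  proof (cases "even m")
    case True
    then obtain k where k: "m = 2 * k" by blast
    have "1 - p ^ Suc (Suc m) = 1 - p ^ 2 * (p ^ 2) ^ k"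
      by (simp add: k power_mult power2_eq_square)
    with nz(2)[of "Suc (Suc m)"] qpoch_nonzero[OF p2 p2, of k] show ?thesis
      by (simp add: c_def k qpoch_Suc del: power_Suc)
  qed (simp add: c_def)
  have a1: "(1 - p ^ Suc m) * a (Suc m) = p ^ m * a m" for m
    using nz(1)[of m] nz(2)[of "Suc m"]
    unfolding a_def qpoch_Suc by (simp add: numeral_2_eq_2 field_simps power_add)
  have rec: "(1 - p ^ Suc (Suc n)) * S (Suc (Suc n)) = S n + p ^ Suc n * S (Suc n)" for n
  proof -
    let ?M = "Suc (Suc n)"
    have "(1 - p ^ ?M) * S ?M
      = (\<Sum>m\<le>?M. (1 - p ^ m) * c m * a (?M - m)) + (\<Sum>m\<le>?M. p ^ m * (1 - p ^ (?M - m)) * c m * a (?M - m))"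
      unfolding sum_distrib_left sum.distrib[symmetric] S_def
      by (intro sum.cong refl) (simp add: algebra_simps flip: power_add)
    also have "(\<Sum>m\<le>?M. (1 - p ^ m) * c m * a (?M - m)) = S n"
      unfolding sum.atMost_Suc_shift S_def by (simp add: c1 del: power_Suc) (simp add: c_def)
    also have "(\<Sum>m\<le>?M. p ^ m * (1 - p ^ (?M - m)) * c m * a (?M - m)) = p ^ Suc n * S (Suc n)"
      unfolding S_def sum_distrib_left
    proof (subst sum.atMost_Suc[of _ "Suc n"], simp del: sum.atMost_Suc, intro sum.cong refl)
      fix m assume "m \<in> {..Suc n}"
      then obtain r where r: "Suc n = m + r" by (auto simp: le_iff_add)
      have "p ^ m * (1 - p ^ Suc r) * c m * a (Suc r) = p ^ m * c m * ((1 - p ^ Suc r) * a (Suc r))"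
        by (simp only: mult_ac)
      also have "\<dots> = p ^ (m + r) * c m * a r"
        unfolding a1 by (simp add: power_add)
      finally show "p ^ m * (1 - p ^ (Suc (Suc n) - m)) * c m * a (Suc (Suc n) - m)
          = p * p ^ n * (c m * a (Suc n - m))"
        unfolding power_Suc[symmetric] r by (simp add: Suc_diff_le r mult_ac del: power_Suc flip: add_Suc_right)
    qed
    finally show ?thesis .
  qed
  have S0: "S n = 1 / qpoch p p n \<and> S (Suc n) = 1 / qpoch p p (Suc n)" for n
  proof (induction n)
    case 0
    show ?case by (simp add: S_def a_def c_def binomial_eq_0)
  next
    case (Suc n)
    have "(1 - p ^ Suc (Suc n)) * S (Suc (Suc n)) = 1 / qpoch p p n + p ^ Suc n * (1 / qpoch p p (Suc n))"
      using rec[of n] Suc.IH by simp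
    also have "1 / qpoch p p n = (1 - p ^ Suc n) * (1 / qpoch p p (Suc n))"
      using nz(2)[of "Suc n"] by (simp add: qpoch_Suc)
    also have "\<dots> + p ^ Suc n * (1 / qpoch p p (Suc n)) = 1 / qpoch p p (Suc n)"
      by (simp flip: add_divide_distrib)
    also have "\<dots> = (1 - p ^ Suc (Suc n)) * (1 / qpoch p p (Suc (Suc n)))"
      using nz(2)[of "Suc (Suc n)"] by (simp add: qpoch_Suc)
    finally have "S (Suc (Suc n)) = 1 / qpoch p p (Suc (Suc n))"
      using nz(2)[of "Suc (Suc n)"] by (subst (asm) mult_left_cancel) auto
    then show ?case using Suc.IH by blast
  qed
  have "(\<Sum>m\<le>n. (if even m then p ^ ((n - m) choose 2) / (qpoch p p (n - m) * qpoch (p ^ 2) (p ^ 2) (m div 2))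
            else 0)) = S n"
    unfolding S_def by (intro sum.cong refl) (auto simp: a_def c_def)
  with S0 show ?thesis by simp
qed

section \<open>The series of Euler and Lebesgue\<close>

text \<open>Tannery's theorem for a limit along the natural numbers and a majorant that is valid for all values
  of the limit variable.\<close>

lemma tannery_sequentially:
  fixes a :: "nat \<Rightarrow> nat \<Rightarrow> complex"
  assumes "\<And>k. (\<lambda>n. a k n) \<longlonglongrightarrow> b k" "\<And>k n. norm (a k n) \<le> M k" "summable M"
  shows "(\<lambda>n. \<Sum>k. a k n) \<longlonglongrightarrow> suminf b" and "summable b"
proof -
  have "eventually (\<lambda>(k, n). norm (a k n) \<le> M k) (at_top \<times>\<^sub>F sequentially)"
    using assms(2) by (intro always_eventually) auto
  from tannerys_theorem[OF assms(1) this assms(3)]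
  show "(\<lambda>n. \<Sum>k. a k n) \<longlonglongrightarrow> suminf b" and "summable b"
    by (auto intro: summable_norm_cancel)
qed

lemma choose_two_Suc: "Suc n choose 2 = n + (n choose 2)"
  by (simp add: numeral_2_eq_2)

lemma choose_two_add: "(m + n) choose 2 = (m choose 2) + (n choose 2) + m * n"
  by (induction n) (simp_all add: choose_two_Suc binomial_eq_0)

lemma summable_theta:
  fixes R r :: real
  assumes "R \<ge> 0" "0 \<le> r" "r < 1"
  shows "summable (\<lambda>n. R ^ n * r ^ (n choose 2))"
proof -
  have "(\<lambda>n. R * r ^ n) \<longlonglongrightarrow> R * 0"
    using assms by (intro tendsto_intros LIMSEQ_power_zero) auto
  then have "eventually (\<lambda>n. R * r ^ n < 1 / 2) sequentially"
    by (rule order_tendstoD) simp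
  then obtain N where N: "\<And>n. n \<ge> N \<Longrightarrow> R * r ^ n < 1 / 2"
    by (auto simp: eventually_sequentially)
  show ?thesis
  proof (rule summable_ratio_test[of "1/2" N])
    fix n assume "n \<ge> N"
    then have "(R * r ^ n) * (R ^ n * r ^ (n choose 2)) \<le> 1 / 2 * (R ^ n * r ^ (n choose 2))"
      using N[of n] assms by (intro mult_right_mono) auto
    then show "norm (R ^ Suc n * r ^ (Suc n choose 2)) \<le> 1 / 2 * norm (R ^ n * r ^ (n choose 2))"
      using assms by (simp add: choose_two_Suc power_add mult_ac)
  qed simp
qed

lemma theta_summable:
  fixes z p :: complex
  assumes "norm p < 1" "\<And>n. norm (b n) \<le> C"
  shows "summable (\<lambda>n. z ^ n * p ^ (n choose 2) * b n)"
proof (rule summable_comparison_test')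
  show "summable (\<lambda>n. (norm z ^ n * norm p ^ (n choose 2)) * C)"
    using assms by (intro summable_mult2 summable_theta) auto
  show "norm (z ^ n * p ^ (n choose 2) * b n) \<le> norm z ^ n * norm p ^ (n choose 2) * C" for n
    unfolding norm_mult norm_power by (intro mult_left_mono assms) auto
qed

text \<open>The limit \<open>N \<rightarrow> \<infinity>\<close> of Rothe's identity: the quotient \<open>(p; p)\<^sub>N / (p; p)\<^sub>N\<^sub>-\<^sub>i\<close> tends
  to 1 and is bounded.\<close>

theorem euler_series:
  fixes p e :: complex
  assumes "norm p < 1"
  shows "(\<lambda>n. e ^ n * p ^ (n choose 2) / qpoch p p n) sums qpoch_inf (- e) p"
proof -
  obtain C where C: "C > 0" "\<And>n. norm (qpoch p p n) \<le> C"
    using qpoch_bounded[OF assms, of p] by metis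
  obtain D where D: "D > 0" "\<And>n. norm (inverse (qpoch p p n)) \<le> D"
    using inverse_qpoch_bounded[OF assms assms] by metis
  note nz = qpoch_nonzero[OF assms assms] qpoch_inf_nonzero[OF assms assms]
  define c where "c i = e ^ i * p ^ (i choose 2) / qpoch p p i" for i
  define a where "a i N = (if i \<le> N then c i * (qpoch p p N * inverse (qpoch p p (N - i))) else 0)" for i N
  have lim: "(\<lambda>N. a i N) \<longlonglongrightarrow> c i" for i
  proof (rule LIMSEQ_offset[where k = i])
    have "(\<lambda>N. c i * (qpoch p p (N + i) * inverse (qpoch p p N))) \<longlonglongrightarrow> c i * (qpoch_inf p p * inverse (qpoch_inf p p))"
      by (intro tendsto_intros qpoch_tendsto LIMSEQ_ignore_initial_segment assms nz)
    then show "(\<lambda>N. a i (N + i)) \<longlonglongrightarrow> c i"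
      using nz by (simp add: a_def)
  qed
  have bound: "norm (a i N) \<le> (norm e ^ i * norm p ^ (i choose 2)) * (D * (C * D))" for i N
  proof (cases "i \<le> N")
    case True
    then have "norm (a i N) = (norm e ^ i * norm p ^ (i choose 2)) *
        (norm (inverse (qpoch p p i)) * (norm (qpoch p p N) * norm (inverse (qpoch p p (N - i)))))"
      by (simp add: a_def c_def norm_mult norm_divide norm_power norm_inverse divide_inverse mult_ac)
    also have "\<dots> \<le> (norm e ^ i * norm p ^ (i choose 2)) * (D * (C * D))"
      using C D by (intro mult_left_mono mult_mono) (auto intro: mult_nonneg_nonneg less_imp_le)
    finally show ?thesis .
  qed (use C D in \<open>auto simp: a_def\<close>)
  have "(\<lambda>i. norm e ^ i * norm p ^ (i choose 2) * (D * (C * D))) sums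
     ((\<Sum>i. norm e ^ i * norm p ^ (i choose 2)) * (D * (C * D)))"
    using assms by (intro sums_mult2 summable_sums summable_theta) auto
  then have sM: "summable (\<lambda>i. norm e ^ i * norm p ^ (i choose 2) * (D * (C * D)))"
    by (rule sums_summable)
  have "(\<Sum>i. a i N) = qpoch (- e) p N" for N
  proof -
    have "(\<Sum>i. a i N) = (\<Sum>i\<le>N. a i N)"
      by (rule suminf_finite) (auto simp: a_def)
    also have "\<dots> = qpoch p p N *
        (\<Sum>i\<le>N. e ^ i * p ^ (i choose 2) / (qpoch p p i * qpoch p p (N - i)))"
      unfolding sum_distrib_left by (intro sum.cong refl) (simp add: a_def c_def divide_simps)
    finally show ?thesis using nz by (simp add: rothe_identity[OF assms])
  qed
  with tannery_sequentially[OF lim bound sM]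
  have "qpoch (- e) p \<longlonglongrightarrow> suminf c" "summable c"
    by simp_all
  then show ?thesis
    using LIMSEQ_unique[OF qpoch_tendsto[OF assms, of "- e"]] unfolding c_def sums_iff by auto
qed

lemma norm_qpoch_le:
  fixes a p :: complex
  assumes "norm p \<le> 1"
  shows "norm (qpoch a p n) \<le> (1 + norm a) ^ n"
proof (induction n)
  case (Suc n)
  have "norm (1 - a * p ^ n) \<le> norm (1::complex) + norm (a * p ^ n)"
    by (rule norm_triangle_ineq4)
  also have "norm (a * p ^ n) \<le> norm a * 1"
    unfolding norm_mult norm_power using assms by (intro mult_left_mono power_le_one) auto
  finally have "norm (1 - a * p ^ n) \<le> 1 + norm a" by simp
  with Suc have "norm (qpoch a p n) * norm (1 - a * p ^ n) \<le> (1 + norm a) ^ n * (1 + norm a)"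
    by (intro mult_mono) auto
  then show ?case by (simp add: qpoch_Suc norm_mult mult_ac)
qed simp

text \<open>Write \<open>L(a)\<close> for the sum. It satisfies \<open>L(a) = (1 + a p) L(a p^2)\<close>, because the difference of
  the two sides telescopes termwise. Iterating collects the factors of \<open>(-a p; p^2)\<close> and moves the
  parameter to 0, where \<open>L(0) = (-p; p)\<close> is Euler's series.\<close>

theorem lebesgue_identity:
  fixes a p :: complex
  assumes "norm p < 1"
  shows "(\<lambda>n. p ^ (Suc n choose 2) * qpoch (- a) p n / qpoch p p n) sums
           (qpoch_inf (- (a * p)) (p ^ 2) * qpoch_inf (- p) p)"
proof -
  have p2: "norm (p ^ 2) < 1"
    using assms by (simp add: norm_power power_less_one_iff)
  note nz = qpoch_nonzero[OF assms assms] qpoch_inf_nonzero[OF assms assms]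
  obtain D where D: "D > 0" "\<And>n. norm (inverse (qpoch p p n)) \<le> D"
    using inverse_qpoch_bounded[OF assms assms] by metis
  define t where "t a n = p ^ (Suc n choose 2) * qpoch (- a) p n / qpoch p p n" for a n
  define M where "M a n = (1 + norm a) ^ n * norm p ^ (n choose 2) * D" for a :: complex and n
  have sM: "summable (M a)" for a
    unfolding M_def using assms by (intro summable_mult2 summable_theta) auto
  have M: "norm (t a' n) \<le> M a n" if "norm a' \<le> norm a" for a' a n
  proof -
    have 1: "norm p ^ (Suc n choose 2) \<le> norm p ^ (n choose 2)"
      using assms by (intro power_decreasing) (auto simp: choose_two_Suc)
    have "norm (qpoch (- a') p n) \<le> (1 + norm (- a')) ^ n"
      using assms by (intro norm_qpoch_le) auto
    also have "\<dots> \<le> (1 + norm a) ^ n"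
      using that by (intro power_mono) auto
    finally have 2: "norm (qpoch (- a') p n) \<le> (1 + norm a) ^ n" .
    have "norm (t a' n) = norm (qpoch (- a') p n) * norm p ^ (Suc n choose 2) * norm (inverse (qpoch p p n))"
      by (simp add: t_def norm_mult norm_divide norm_power norm_inverse divide_inverse mult_ac)
    also have "\<dots> \<le> M a n"
      unfolding M_def by (intro mult_mono 1 2 D) (auto intro!: mult_nonneg_nonneg)
    finally show ?thesis .
  qed
  have st: "summable (t a)" for a
    by (rule summable_comparison_test'[OF sM[of a], of 0]) (auto intro!: M)
  have rec: "suminf (t a) = (1 + a * p) * suminf (t (a * p ^ 2))" for a
  proof -
    \<comment> \<open>The certificate is \<open>a (1 - p^n) / (1 + a)\<close> times the n-th term; the cancelled form avoids
        dividing by \<open>1 + a\<close>, and the factor \<open>1 - p^n\<close> makes it vanish at \<open>n = 0\<close>.\<close>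
    define G where "G n = (case n of 0 \<Rightarrow> 0 | Suc k \<Rightarrow> a * p ^ (Suc n choose 2) * qpoch (- (a * p)) p k / qpoch p p k)" for n
    have tele: "G (Suc n) - G n = (1 + a * p) * t (a * p ^ 2) n - t a n" for n
    proof (cases n)
      case 0
      then show ?thesis
        by (simp add: G_def t_def choose_two_Suc binomial_eq_0 algebra_simps power2_eq_square)
    next
      case (Suc k)
      define P where "P = p ^ Suc k"
      define X where "X = p ^ (Suc (Suc k) choose 2)"
      define y where "y = qpoch p p k"
      define A where "A = qpoch (- (a * p)) p k"
      have nzP: "1 - P \<noteq> 0" "y \<noteq> 0"
        using one_minus_power_nonzero[OF assms, of "Suc k"] nz by (auto simp: P_def y_def)
      define W where "W = y * (1 - P)"
      have nzW: "W \<noteq> 0" using nzP by (simp add: W_def)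
      have y1: "qpoch p p (Suc k) = y * (1 - P)"
        by (simp add: qpoch_Suc y_def P_def)
      have A1: "qpoch (- (a * p)) p (Suc k) = A * (1 + a * P)"
        by (simp add: qpoch_Suc A_def P_def mult_ac)
      have A0: "qpoch (- a) p (Suc k) = (1 + a) * A"
        by (simp add: qpoch_Suc' A_def)
      have A2: "(1 + a * p) * qpoch (- (a * p ^ 2)) p (Suc k) = A * (1 + a * P) * (1 + a * p * P)"
      proof -
        have "(1 + a * p) * qpoch (- (a * p ^ 2)) p (Suc k) = qpoch (- (a * p)) p (Suc (Suc k))"
          by (simp add: qpoch_Suc'[of "- (a * p)" p "Suc k"] power2_eq_square mult_ac)
        also have "\<dots> = A * (1 + a * P) * (1 + a * p * P)"
          unfolding qpoch_Suc[of _ _ "Suc k"] A1 by (simp add: P_def mult_ac)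
        finally show ?thesis .
      qed
      have X1: "p ^ (Suc (Suc (Suc k)) choose 2) = p * P * X"
        by (simp add: choose_two_Suc X_def P_def power_add mult_ac)
      have "(G (Suc n) - G n) * (y * (1 - P)) = a * (p * P * X) * (A * (1 + a * P)) - a * X * A * (1 - P)"
        unfolding Suc G_def nat.case X1 A1 y1 using nzP
        by (simp add: X_def[symmetric] A_def[symmetric] y_def[symmetric] field_simps)
      also have "\<dots> = X * (A * (1 + a * P) * (1 + a * p * P)) - X * ((1 + a) * A)"
        by (simp add: algebra_simps)
      also have "\<dots> = ((1 + a * p) * t (a * p ^ 2) n - t a n) * (y * (1 - P))"
        unfolding A2[symmetric] A0[symmetric] Suc t_def y1 X_def[symmetric] W_def[symmetric]
        using nzW by (simp add: field_simps)
      finally show ?thesis using nzP by simp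
    qed
    have "(\<lambda>k. a * (p ^ Suc k * (p ^ (Suc k choose 2))) * qpoch (- (a * p)) p k / qpoch p p k) \<longlonglongrightarrow>
            a * (0 * 0) * qpoch_inf (- (a * p)) p / qpoch_inf p p"
    proof (intro tendsto_intros qpoch_tendsto assms nz)
      show "(\<lambda>k. p ^ Suc k) \<longlonglongrightarrow> 0"
        by (intro LIMSEQ_Suc LIMSEQ_power_zero assms)
      have "(\<lambda>k. 1 ^ k * p ^ (k choose 2) * (1::complex)) \<longlonglongrightarrow> 0"
        by (intro summable_LIMSEQ_zero theta_summable[where C = 1] assms) simp
      from LIMSEQ_Suc[OF this] show "(\<lambda>k. p ^ (Suc k choose 2)) \<longlonglongrightarrow> 0" by simp
    qed
    moreover have "p ^ (Suc (Suc k) choose 2) = p ^ Suc k * p ^ (Suc k choose 2)" for k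
      by (simp only: choose_two_Suc[of "Suc k"] power_add)
    ultimately have "(\<lambda>k. G (Suc k)) \<longlonglongrightarrow> 0"
      by (simp add: G_def del: power_Suc)
    then have "G \<longlonglongrightarrow> 0" by (rule LIMSEQ_imp_Suc)
    from telescope_sums[OF this]
    have "(\<lambda>n. (1 + a * p) * t (a * p ^ 2) n - t a n) sums 0"
      unfolding tele by (simp add: G_def)
    moreover have "(\<lambda>n. (1 + a * p) * t (a * p ^ 2) n - t a n) sums
        ((1 + a * p) * suminf (t (a * p ^ 2)) - suminf (t a))"
      by (intro sums_diff sums_mult summable_sums st)
    ultimately show ?thesis using sums_unique2 by fastforce
  qed
  have iter: "suminf (t a) = qpoch (- (a * p)) (p ^ 2) N * suminf (t (a * (p ^ 2) ^ N))" for N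
    by (induction N) (simp_all add: qpoch_Suc rec[of "a * (p ^ 2) ^ _"] mult_ac)
  have lim: "(\<lambda>N. t (a * (p ^ 2) ^ N) n) \<longlonglongrightarrow> t 0 n" for n
  proof -
    have "(\<lambda>N. p ^ (Suc n choose 2) * (\<Prod>m<n. 1 - - (a * (p ^ 2) ^ N) * p ^ m) / qpoch p p n) \<longlonglongrightarrow>
       p ^ (Suc n choose 2) * (\<Prod>m<n. 1 - - (a * 0) * p ^ m) / qpoch p p n"
      by (intro tendsto_intros LIMSEQ_power_zero p2 nz)
    then show ?thesis by (simp add: t_def qpoch_def)
  qed
  have "(\<lambda>N. suminf (t (a * (p ^ 2) ^ N))) \<longlonglongrightarrow> suminf (t 0)"
  proof (rule tannery_sequentially(1)[OF lim M[of _ a] sM])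
    show "norm (a * (p ^ 2) ^ N) \<le> norm a" for N
      unfolding norm_mult norm_power using assms
      by (intro mult_left_le power_le_one) auto
  qed
  then have "(\<lambda>N. qpoch (- (a * p)) (p ^ 2) N * suminf (t (a * (p ^ 2) ^ N))) \<longlonglongrightarrow>
      qpoch_inf (- (a * p)) (p ^ 2) * suminf (t 0)"
    by (intro tendsto_intros qpoch_tendsto p2)
  then have "suminf (t a) = qpoch_inf (- (a * p)) (p ^ 2) * suminf (t 0)"
    unfolding iter[symmetric] by (simp add: LIMSEQ_const_iff)
  also have "t 0 = (\<lambda>n. p ^ n * p ^ (n choose 2) / qpoch p p n)"
    by (simp add: fun_eq_iff t_def choose_two_Suc power_add qpoch_def)
  also have "suminf \<dots> = qpoch_inf (- p) p"
    by (rule sums_unique[OF euler_series[OF assms], symmetric])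
  finally show ?thesis
    using summable_sums[OF st[of a]] unfolding t_def by simp
qed

section \<open>The Jacobi triple product\<close>

lemma sum_atMost_add_split:
  fixes f :: "nat \<Rightarrow> complex"
  shows "(\<Sum>i\<le>M + N. f i) = (\<Sum>i<M. f i) + (\<Sum>n\<le>N. f (M + n))"
  by (induction N) (simp_all flip: lessThan_Suc_atMost)

lemma qpoch_divide_power:
  fixes p z :: complex
  assumes "p \<noteq> 0" "z \<noteq> 0"
  shows "qpoch (z / p ^ N) p N = (- z) ^ N / p ^ (Suc N choose 2) * qpoch (p / z) p N"
proof (induction N)
  case (Suc N)
  have "qpoch (z / p ^ Suc N) p (Suc N) = (1 - z / p ^ Suc N) * qpoch (z / p ^ N) p N"
    using assms by (simp add: qpoch_Suc')
  also have "1 - z / p ^ Suc N = - z / p ^ Suc N * (1 - p / z * p ^ N)"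
    using assms by (simp add: field_simps)
  finally show ?case
    unfolding Suc by (simp add: qpoch_Suc choose_two_Suc[of "Suc N"] power_add mult_ac)
qed (simp add: binomial_eq_0)

text \<open>Rothe's identity with \<open>2N\<close> in place of \<open>N\<close> and \<open>e = -z / p^N\<close>, re-centred at its middle term
  \<open>i = N\<close>: the terms above the middle carry the powers of \<open>z\<close>, those below the powers of
  \<open>p / z\<close>, and the product splits in the middle in the same way.\<close>

lemma finite_triple_product:
  fixes p z :: complex
  assumes "norm p < 1" "p \<noteq> 0" "z \<noteq> 0"
  defines "B \<equiv> (\<lambda>N n. qpoch p p (N + N) / (qpoch p p (N + n) * qpoch p p (N - n)))"
  shows "(\<Sum>n\<le>N. (- z) ^ n * p ^ (n choose 2) * B N n) +
         (\<Sum>n<N. (- (p / z)) ^ Suc n * p ^ (Suc n choose 2) * B N (Suc n))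
          = qpoch z p N * qpoch (p / z) p N"
proof -
  note nz = qpoch_nonzero[OF assms(1) assms(1)]
  \<comment> \<open>The common factor that re-centring extracts from every term and from the product.\<close>
  define K where "K = (- z) ^ N / p ^ (Suc N choose 2)"
  have K: "K \<noteq> 0" using assms(2,3) by (simp add: K_def)
  define f where "f i = (- (z / p ^ N)) ^ i * p ^ (i choose 2) / (qpoch p p i * qpoch p p (N + N - i))" for i
  have up: "f (N + n) * qpoch p p (N + N) = K * ((- z) ^ n * p ^ (n choose 2) * B N n)" if "n \<le> N" for n
  proof -
    have e: "((N + n) choose 2) + (Suc N choose 2) = (n choose 2) + N * (N + n)"
      unfolding choose_two_add choose_two_Suc
      by (induction N) (simp_all add: choose_two_Suc binomial_eq_0 algebra_simps)
    have "p ^ ((N + n) choose 2) * p ^ (Suc N choose 2) = p ^ (n choose 2) * p ^ (N * (N + n))"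
      unfolding power_add[symmetric] e ..
    then have e': "p ^ ((N + n) choose 2) / p ^ (N * (N + n)) = p ^ (n choose 2) / p ^ (Suc N choose 2)"
      by (intro frac_eq_eq[THEN iffD2]) (use assms(2) in simp_all)
    have "(- (z / p ^ N)) ^ (N + n) * p ^ ((N + n) choose 2) =
        (- z) ^ (N + n) * (p ^ ((N + n) choose 2) / p ^ (N * (N + n)))"
      unfolding minus_divide_left power_divide power_mult[symmetric] by simp
    also have "\<dots> = K * ((- z) ^ n * p ^ (n choose 2))"
      unfolding e' K_def by (simp add: power_add)
    finally have "f (N + n) = K * ((- z) ^ n * p ^ (n choose 2)) / (qpoch p p (N + n) * qpoch p p (N - n))"
      unfolding f_def by (simp only: add_diff_cancel_left)
    then show ?thesis
      unfolding B_def by (simp only: times_divide_eq_left times_divide_eq_right mult_ac)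
  qed
  have down: "f (N - Suc n) * qpoch p p (N + N) = K * ((- (p / z)) ^ Suc n * p ^ (Suc n choose 2) * B N (Suc n))"
    if "n < N" for n
  proof -
    from less_imp_Suc_add[OF that] obtain m where m: "N = Suc n + m" by auto
    have e: "(m choose 2) + (Suc N choose 2) = Suc n + (Suc n choose 2) + N * m"
      unfolding m choose_two_add choose_two_Suc
      by (induction m) (simp_all add: choose_two_Suc binomial_eq_0 algebra_simps)
    have "p ^ (m choose 2) * p ^ (Suc N choose 2) = p ^ Suc n * p ^ (Suc n choose 2) * p ^ (N * m)"
      unfolding power_add[symmetric] e ..
    then have e': "p ^ (m choose 2) / p ^ (N * m) = p ^ Suc n * p ^ (Suc n choose 2) / p ^ (Suc N choose 2)"
      by (intro frac_eq_eq[THEN iffD2]) (use assms(2) in simp_all)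
    have zz: "(- z) ^ N * (- (p / z)) ^ Suc n = (- z) ^ m * p ^ Suc n"
    proof -
      have "(- z) ^ N * (- (p / z)) ^ Suc n = (- z) ^ m * ((- z) * (- (p / z))) ^ Suc n"
        unfolding m power_add power_mult_distrib by (simp only: mult_ac)
      also have "(- z) * (- (p / z)) = p" using assms(2,3) by simp
      finally show ?thesis .
    qed
    have "(- (z / p ^ N)) ^ m * p ^ (m choose 2) = (- z) ^ m * (p ^ (m choose 2) / p ^ (N * m))"
      unfolding minus_divide_left power_divide power_mult[symmetric] by simp
    also have "\<dots> = (- z) ^ m * p ^ Suc n * p ^ (Suc n choose 2) / p ^ (Suc N choose 2)"
      unfolding e' by simp
    also have "\<dots> = K * ((- (p / z)) ^ Suc n * p ^ (Suc n choose 2))"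
      unfolding zz[symmetric] K_def by (simp only: times_divide_eq_left times_divide_eq_right mult_ac)
    finally have "(- (z / p ^ N)) ^ m * p ^ (m choose 2) = K * ((- (p / z)) ^ Suc n * p ^ (Suc n choose 2))" .
    moreover have "N - Suc n = m" "N + N - m = N + Suc n" using m by auto
    ultimately have "f (N - Suc n) =
        K * ((- (p / z)) ^ Suc n * p ^ (Suc n choose 2)) / (qpoch p p m * qpoch p p (N + Suc n))"
      unfolding f_def by (simp only:)
    then show ?thesis
      unfolding B_def \<open>N - Suc n = m\<close> by (simp only: times_divide_eq_left times_divide_eq_right mult_ac)
  qed
  have "K * (qpoch z p N * qpoch (p / z) p N) = qpoch (z / p ^ N) p (N + N)"
    unfolding qpoch_add qpoch_divide_power[OF assms(2,3)] K_def using assms(2,3) by simp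
  also have "\<dots> = (\<Sum>i\<le>N + N. f i) * qpoch p p (N + N)"
    unfolding f_def rothe_identity[OF assms(1)] using nz by simp
  also have "(\<Sum>i\<le>N + N. f i) = (\<Sum>n<N. f (N - Suc n)) + (\<Sum>n\<le>N. f (N + n))"
    unfolding sum_atMost_add_split by (simp only: sum.nat_diff_reindex[of f N])
  also have "\<dots> * qpoch p p (N + N) =
     K * ((\<Sum>n\<le>N. (- z) ^ n * p ^ (n choose 2) * B N n) +
         (\<Sum>n<N. (- (p / z)) ^ Suc n * p ^ (Suc n choose 2) * B N (Suc n)))"
  proof -
    have "(\<Sum>n<N. f (N - Suc n)) * qpoch p p (N + N) =
        K * (\<Sum>n<N. (- (p / z)) ^ Suc n * p ^ (Suc n choose 2) * B N (Suc n))"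
      unfolding sum_distrib_left sum_distrib_right by (intro sum.cong refl down) simp
    moreover have "(\<Sum>n\<le>N. f (N + n)) * qpoch p p (N + N) =
        K * (\<Sum>n\<le>N. (- z) ^ n * p ^ (n choose 2) * B N n)"
      unfolding sum_distrib_left sum_distrib_right by (intro sum.cong refl up) simp
    ultimately show ?thesis by (simp only: ring_distribs add.commute)
  qed
  finally show ?thesis using K by simp
qed

text \<open>The bilateral series \<open>\<Sum>n\<in>\<int>. (-z)^n p^(n(n-1)/2)\<close>, split into its terms with \<open>n \<ge> 0\<close> and, with
  \<open>n\<close> replaced by \<open>-n-1\<close>, those with negative index. The Gaussian binomials of the finite form tend to
  \<open>1 / (p; p)\<close>.\<close>

theorem jacobi_triple_product:
  fixes p z :: complex
  assumes "norm p < 1" "p \<noteq> 0" "z \<noteq> 0"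
  shows "(\<Sum>n. (- z) ^ n * p ^ (n choose 2)) + (\<Sum>n. (- (p / z)) ^ Suc n * p ^ (Suc n choose 2))
           = qpoch_inf z p * qpoch_inf (p / z) p * qpoch_inf p p"
proof -
  obtain C where C: "C > 0" "\<And>n. norm (qpoch p p n) \<le> C"
    using qpoch_bounded[OF assms(1), of p] by metis
  obtain D where D: "D > 0" "\<And>n. norm (inverse (qpoch p p n)) \<le> D"
    using inverse_qpoch_bounded[OF assms(1) assms(1)] by metis
  note nz = qpoch_nonzero[OF assms(1,1)] qpoch_inf_nonzero[OF assms(1,1)]
  define B where "B N n = qpoch p p (N + N) / (qpoch p p (N + n) * qpoch p p (N - n))" for N n
  have B_bound: "norm (B N n) \<le> C * (D * D)" for N n
  proof -
    have "norm (B N n) = norm (qpoch p p (N + N)) *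
       (norm (inverse (qpoch p p (N + n))) * norm (inverse (qpoch p p (N - n))))"
      by (simp add: B_def norm_mult norm_divide norm_inverse divide_inverse)
    also have "\<dots> \<le> C * (D * D)"
      using C D by (intro mult_mono) (auto intro: mult_nonneg_nonneg less_imp_le)
    finally show ?thesis .
  qed
  have B_lim: "(\<lambda>N. B N n) \<longlonglongrightarrow> inverse (qpoch_inf p p)" for n
  proof -
    have "filterlim (\<lambda>N::nat. N + N) at_top at_top"
      by (intro filterlim_subseq strict_monoI) auto
    note 1 = filterlim_compose[OF qpoch_tendsto[OF assms(1), of p] this]
    note 2 = filterlim_compose[OF qpoch_tendsto[OF assms(1), of p] filterlim_minus_const_nat_at_top[of n]]
    have "(\<lambda>N. B N n) \<longlonglongrightarrow> qpoch_inf p p / (qpoch_inf p p * qpoch_inf p p)"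
      unfolding B_def
      by (intro tendsto_intros 1 2 LIMSEQ_ignore_initial_segment qpoch_tendsto assms) (use nz in auto)
    then show ?thesis using nz by (simp add: inverse_eq_divide)
  qed
  have main: "(\<lambda>N. \<Sum>n. if n + d \<le> N then c n * B N (n + d) else 0) \<longlonglongrightarrow> (\<Sum>n. c n * inverse (qpoch_inf p p))"
    if "summable (\<lambda>n. norm (c n))" for c :: "nat \<Rightarrow> complex" and d :: nat
  proof -
    have lim: "(\<lambda>N. if n + d \<le> N then c n * B N (n + d) else 0) \<longlonglongrightarrow> c n * inverse (qpoch_inf p p)" for n
    proof (rule Lim_transform_eventually)
      show "(\<lambda>N. c n * B N (n + d)) \<longlonglongrightarrow> c n * inverse (qpoch_inf p p)"
        by (intro tendsto_intros B_lim)
      show "eventually (\<lambda>N. c n * B N (n + d) = (if n + d \<le> N then c n * B N (n + d) else 0)) sequentially"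
        using eventually_ge_at_top[of "n + d"] by eventually_elim simp
    qed
    have bound: "norm (if n + d \<le> N then c n * B N (n + d) else 0) \<le> norm (c n) * (C * (D * D))" for n N
      using C D B_bound[of N "n + d"] by (auto simp: norm_mult intro: mult_left_mono)
    show ?thesis
      by (rule tannery_sequentially(1)[OF lim bound summable_mult2[OF that]])
  qed
  define c1 where "c1 n = (- z) ^ n * p ^ (n choose 2)" for n
  define c2 where "c2 n = (- (p / z)) ^ Suc n * p ^ (Suc n choose 2)" for n
  have s1: "summable (\<lambda>n. norm (c1 n))"
    using summable_theta[of "norm z" "norm p"] assms(1) by (simp add: c1_def norm_mult norm_power)
  have s2: "summable (\<lambda>n. norm (c2 n))"
    using summable_ignore_initial_segment[OF summable_theta[of "norm (p / z)" "norm p"], of 1] assms(1)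
    by (simp add: c2_def norm_mult norm_power del: power_Suc)
  have "(\<Sum>n. if n + 0 \<le> N then c1 n * B N (n + 0) else 0) + (\<Sum>n. if n + 1 \<le> N then c2 n * B N (n + 1) else 0)
      = qpoch z p N * qpoch (p / z) p N" for N
  proof -
    have "(\<Sum>n. if n + 0 \<le> N then c1 n * B N (n + 0) else 0) = (\<Sum>n\<le>N. c1 n * B N n)"
      by (subst suminf_finite[of "{..N}"]) auto
    moreover have "(\<Sum>n. if n + 1 \<le> N then c2 n * B N (n + 1) else 0) = (\<Sum>n<N. c2 n * B N (Suc n))"
      by (subst suminf_finite[of "{..<N}"]) auto
    ultimately show ?thesis
      using finite_triple_product[OF assms, of N] unfolding c1_def c2_def B_def by simp
  qed
  with tendsto_add[OF main[OF s1, of 0] main[OF s2, of 1]]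
  have "(\<lambda>N. qpoch z p N * qpoch (p / z) p N) \<longlonglongrightarrow>
      (\<Sum>n. c1 n * inverse (qpoch_inf p p)) + (\<Sum>n. c2 n * inverse (qpoch_inf p p))"
    by (simp only:)
  moreover have "(\<lambda>N. qpoch z p N * qpoch (p / z) p N) \<longlonglongrightarrow> qpoch_inf z p * qpoch_inf (p / z) p"
    by (intro tendsto_intros qpoch_tendsto assms)
  ultimately have "(\<Sum>n. c1 n * inverse (qpoch_inf p p)) + (\<Sum>n. c2 n * inverse (qpoch_inf p p))
      = qpoch_inf z p * qpoch_inf (p / z) p"
    by (rule LIMSEQ_unique)
  then have "(suminf c1 + suminf c2) * inverse (qpoch_inf p p) = qpoch_inf z p * qpoch_inf (p / z) p"
    using s1 s2 by (simp add: suminf_mult2[symmetric] summable_norm_cancel ring_distribs)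
  then show ?thesis
    using nz unfolding c1_def[symmetric] c2_def[symmetric] by (simp add: field_simps)
qed

section \<open>The Goellnitz-Gordon identities\<close>

text \<open>A second-order recurrence with summable perturbation determines its solution from the limit at
  infinity: \<open>max |d\<^sub>m| |d\<^sub>m\<^sub>+\<^sub>1|\<close> grows at most by the factor \<open>1 + |a\<^sub>m| + |b\<^sub>m|\<close> in each step towards
  smaller \<open>m\<close>, and the product of these factors converges.\<close>

lemma recurrence_zero_if_tendsto_zero:
  fixes d a b :: "nat \<Rightarrow> complex"
  assumes rec: "\<And>m. d m = (1 + a m) * d (Suc m) + b m * d (Suc (Suc m))"
    and "summable (\<lambda>m. norm (a m))" "summable (\<lambda>m. norm (b m))" and "d \<longlonglongrightarrow> 0"
  shows "d m = 0"
proof -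
  define c where "c m = norm (a m) + norm (b m)" for m
  have c: "summable c" "\<And>m. c m \<ge> 0"
    unfolding c_def using assms by (auto intro: summable_add)
  define e where "e m = max (norm (d m)) (norm (d (Suc m)))" for m
  have e0: "e m \<ge> 0" for m
    by (simp add: e_def le_max_iff_disj)
  have step: "e m \<le> (1 + c m) * e (Suc m)" for m
  proof -
    have "norm (d m) \<le> norm (1 + a m) * norm (d (Suc m)) + norm (b m) * norm (d (Suc (Suc m)))"
      unfolding rec[of m] by (rule order_trans[OF norm_triangle_ineq]) (simp add: norm_mult)
    also have "\<dots> \<le> (1 + norm (a m)) * e (Suc m) + norm (b m) * e (Suc m)"
      using norm_triangle_ineq[of 1 "a m"]
      by (intro add_mono mult_mono) (auto simp: e_def)
    finally have 1: "norm (d m) \<le> (1 + c m) * e (Suc m)"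
      by (simp add: c_def algebra_simps)
    have "norm (d (Suc m)) \<le> 1 * e (Suc m)"
      by (simp add: e_def)
    also have "\<dots> \<le> (1 + c m) * e (Suc m)"
      using c(2)[of m] e0[of "Suc m"] by (intro mult_right_mono) auto
    finally show ?thesis using 1 by (simp add: e_def[of m])
  qed
  have iter: "e m \<le> (\<Prod>i<k. 1 + c (m + i)) * e (m + k)" for k
  proof (induction k)
    case (Suc k)
    have "(\<Prod>i<k. 1 + c (m + i)) * e (m + k) \<le> (\<Prod>i<k. 1 + c (m + i)) * ((1 + c (m + k)) * e (Suc (m + k)))"
      using c(2) by (intro mult_left_mono step prod_nonneg) (auto intro: add_nonneg_nonneg)
    with Suc show ?case by (simp add: mult_ac)
  qed simp
  have bound: "e m \<le> exp (suminf c) * e (m + k)" for k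
  proof -
    have "(\<Prod>i<k. 1 + c (m + i)) \<le> exp (\<Sum>i<k. c (m + i))"
      by (rule prod_le_exp_sum) (rule c(2))
    also have "(\<Sum>i<k. c (m + i)) = (\<Sum>j\<in>(+) m ` {..<k}. c j)"
      by (subst sum.reindex) auto
    also have "exp \<dots> \<le> exp (suminf c)"
      using c by (auto intro!: sum_le_suminf)
    finally show ?thesis
      using iter[of k] e0[of "m + k"] by (meson mult_right_mono order_trans)
  qed
  have "(\<lambda>k. max (norm (d (k + m))) (norm (d (k + Suc m)))) \<longlonglongrightarrow> max (norm (0::complex)) (norm (0::complex))"
    by (intro tendsto_max tendsto_norm LIMSEQ_ignore_initial_segment assms)
  then have "(\<lambda>k. exp (suminf c) * e (m + k)) \<longlonglongrightarrow> exp (suminf c) * 0"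
    by (intro tendsto_intros) (simp add: e_def add_ac)
  then have "e m \<le> exp (suminf c) * 0"
    by (rule LIMSEQ_le_const) (auto intro: bound)
  then show ?thesis by (simp add: e_def)
qed

text \<open>The termwise identity behind the telescoping of the theta-like series, with denominators cleared;
  here \<open>x = q^(2m)\<close> and \<open>y = q^(2n)\<close>. The variable \<open>r\<close> stands for \<open>(1 - y) / (1 - x y)\<close>. It is
  constrained only by its defining equation, since for \<open>m = n = 0\<close> the quotient is \<open>0 / 0\<close>; the identity
  holds for every \<open>r\<close> subject to the equation because the terms without \<open>r\<close> are divisible by
  \<open>1 - y\<close> and those with \<open>r\<close> by \<open>1 - x y\<close>, with opposite cofactors.\<close>

lemma gg_polynomial_identity:
  fixes x y q r :: complex
  assumes "r * (1 - x * y) = 1 - y"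
  shows "(1 + x * y * q) * (1 + x * y * q ^ 3) * (1 + x * y * r)
       - (1 + x * q) * y ^ 2 * (1 + x * y * q ^ 3) * ((1 - x * y * q ^ 2) + x * q ^ 2 * y * (1 - y))
       - x * q ^ 2 * y ^ 4 * (1 - x * y * q ^ 2) * ((1 - x * y * q ^ 4) + x * q ^ 4 * y * (1 - y))
     = - (x ^ 2 * y ^ 4 * q ^ 3 * (1 + q * y)) * (- 1 - (1 + x * q) * (q ^ 2 * y) + x * (q ^ 2 * y) ^ 2)
       - r * (1 + x * y * q ^ 3) * (- 1 - (1 + x * q) * y + x * y ^ 2)"
proof -
  have "(1 + x * y * q) * (1 + x * y * q ^ 3)
       - (1 + x * q) * y ^ 2 * (1 + x * y * q ^ 3) * ((1 - x * y * q ^ 2) + x * q ^ 2 * y * (1 - y))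
       - x * q ^ 2 * y ^ 4 * (1 - x * y * q ^ 2) * ((1 - x * y * q ^ 4) + x * q ^ 4 * y * (1 - y))
       + (x ^ 2 * y ^ 4 * q ^ 3 * (1 + q * y)) * (- 1 - (1 + x * q) * (q ^ 2 * y) + x * (q ^ 2 * y) ^ 2)
     = (1 - y) * (1 + x * y * q ^ 3) * (1 + y + x * q * y)"
    by algebra
  also have "\<dots> = r * ((1 - x * y) * (1 + x * y * q ^ 3) * (1 + y + x * q * y))"
    unfolding assms[symmetric] by (simp only: mult_ac)
  finally show ?thesis by algebra
qed

lemma suminf_indicator_0: "(\<Sum>n::nat. if n = 0 then 1 else 0 :: complex) = 1"
  by (subst suminf_finite[of "{0}"]) auto

context
  fixes q :: complex
  assumes q: "norm q < 1" "q \<noteq> 0"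
begin

lemma norm_power_q_less_1: "n > 0 \<Longrightarrow> norm (q ^ n) < 1"
  using q by (simp add: norm_power power_less_one_iff)

lemma norm_power_q_le_1: "norm (q ^ n) \<le> 1"
  using q by (simp add: norm_power power_le_one)

lemma one_plus_power_q_nonzero: "1 + q ^ Suc n \<noteq> 0"
  using norm_power_q_less_1[of "Suc n"] by (metis add_eq_0_iff norm_minus_cancel norm_one order_less_irrefl zero_less_Suc)

lemma one_minus_power_q_nonzero: "n > 0 \<Longrightarrow> 1 - q ^ n \<noteq> 0"
  by (rule one_minus_power_nonzero[OF q(1)])

lemma norm_one_minus_power_q_ge: "n > 0 \<Longrightarrow> 1 - norm q \<le> norm (1 - q ^ n)"
proof -
  assume "n > 0"
  then have "norm (q ^ n) \<le> norm q ^ 1"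
    unfolding norm_power using q by (intro power_decreasing) auto
  then show ?thesis
    using norm_triangle_ineq2[of 1 "q ^ n"] by simp
qed

definition gg_coeff :: "nat \<Rightarrow> complex" where
  "gg_coeff n = qpoch (- q) (q ^ 2) n / qpoch (q ^ 2) (q ^ 2) n"

text \<open>The product \<open>(-x q; q^2) / (x q^2; q^2)\<close> at \<open>x = q^(2k)\<close>. The coefficient \<open>gg_coeff n\<close> consists of
  the first \<open>n\<close> factors of the same quotient at \<open>x = 1\<close>.\<close>

definition gg_tail :: "nat \<Rightarrow> complex" where
  "gg_tail k = qpoch_inf (- (q ^ (2 * k + 1))) (q ^ 2) / qpoch_inf (q ^ (2 * k + 2)) (q ^ 2)"

lemma gg_coeff_0 [simp]: "gg_coeff 0 = 1"
  by (simp add: gg_coeff_def)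

lemma gg_coeff_Suc: "gg_coeff (Suc n) * (1 - q ^ (2 * n + 2)) = gg_coeff n * (1 + q ^ (2 * n + 1))"
  using one_minus_power_q_nonzero[of "2 * n + 2"]
    qpoch_nonzero[OF norm_power_q_less_1[of 2] norm_power_q_less_1[of 2], of n]
  by (simp add: gg_coeff_def qpoch_Suc power_add power_mult power2_eq_square field_simps)

lemma gg_tail_Suc: "gg_tail k * (1 - q ^ (2 * k + 2)) = (1 + q ^ (2 * k + 1)) * gg_tail (Suc k)"
proof -
  have 1: "qpoch_inf (- (q ^ (2 * k + 1))) (q ^ 2) = (1 + q ^ (2 * k + 1)) * qpoch_inf (- (q ^ (2 * Suc k + 1))) (q ^ 2)"
  proof -
    have "- (q ^ (2 * k + 1)) * q ^ 2 = - (q ^ (2 * Suc k + 1))"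
      by (simp add: power2_eq_square)
    then show ?thesis
      unfolding qpoch_inf_rec[OF norm_power_q_less_1[of 2], of "- (q ^ (2 * k + 1))", OF zero_less_numeral]
      by (simp only: diff_minus_eq_add)
  qed
  have 2: "qpoch_inf (q ^ (2 * k + 2)) (q ^ 2) = (1 - q ^ (2 * k + 2)) * qpoch_inf (q ^ (2 * Suc k + 2)) (q ^ 2)"
  proof -
    have "q ^ (2 * k + 2) * q ^ 2 = q ^ (2 * Suc k + 2)"
      by (simp add: power2_eq_square)
    then show ?thesis
      unfolding qpoch_inf_rec[OF norm_power_q_less_1[of 2], of "q ^ (2 * k + 2)", OF zero_less_numeral]
      by (simp only:)
  qed
  show ?thesis
    unfolding gg_tail_def 1 2 using one_minus_power_q_nonzero[of "2 * k + 2"] by simp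
qed

lemma gg_coeff_tail: "gg_coeff n * gg_tail n = gg_tail 0"
proof (induction n)
  case (Suc n)
  have "(gg_coeff (Suc n) * gg_tail (Suc n)) * ((1 - q ^ (2 * n + 2)) * (1 + q ^ (2 * n + 1)))
      = (gg_coeff (Suc n) * (1 - q ^ (2 * n + 2))) * ((1 + q ^ (2 * n + 1)) * gg_tail (Suc n))"
    by (simp only: mult_ac)
  also have "\<dots> = (gg_coeff n * gg_tail n) * ((1 - q ^ (2 * n + 2)) * (1 + q ^ (2 * n + 1)))"
    unfolding gg_coeff_Suc gg_tail_Suc[symmetric] by (simp only: mult_ac)
  finally show ?case
    using Suc one_minus_power_q_nonzero[of "2 * n + 2"] one_plus_power_q_nonzero[of "2 * n"]
    by (subst (asm) mult_right_cancel) auto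
qed simp

lemma gg_tail_tendsto: "gg_tail \<longlonglongrightarrow> 1"
proof -
  have "(\<lambda>k. qpoch_inf (- q * (q ^ 2) ^ k) (q ^ 2) / qpoch_inf (q ^ 2 * (q ^ 2) ^ k) (q ^ 2)) \<longlonglongrightarrow> 1 / 1"
    using q norm_power_q_less_1[of 2]
    by (intro tendsto_divide qpoch_inf_power_tendsto_1) auto
  moreover have "gg_tail = (\<lambda>k. qpoch_inf (- q * (q ^ 2) ^ k) (q ^ 2) / qpoch_inf (q ^ 2 * (q ^ 2) ^ k) (q ^ 2))"
  proof
    fix k
    have "- (q ^ (2 * k + 1)) = - q * (q ^ 2) ^ k" "q ^ (2 * k + 2) = q ^ 2 * (q ^ 2) ^ k"
      by (simp_all add: power_add power_mult power2_eq_square)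
    then show "gg_tail k = qpoch_inf (- q * (q ^ 2) ^ k) (q ^ 2) / qpoch_inf (q ^ 2 * (q ^ 2) ^ k) (q ^ 2)"
      unfolding gg_tail_def by (simp only:)
  qed
  ultimately show ?thesis by simp
qed

text \<open>The \<open>n\<close>-th term of the Goellnitz-Gordon series \<open>\<Sum>n. x^n q^(n^2) (-q; q^2)\<^sub>n / (q^2; q^2)\<^sub>n\<close> at
  \<open>x = q^(2m)\<close>.\<close>

definition gg_term :: "nat \<Rightarrow> nat \<Rightarrow> complex" where
  "gg_term m n = (q ^ (2 * m + 1)) ^ n * (q ^ 2) ^ (n choose 2) * gg_coeff n"

text \<open>For \<open>m = n = 0\<close> the value is \<open>0 / 0 = 0\<close>, which is what \<open>gg_theta_term\<close> needs there:
  its term with index \<open>n = 0\<close> is \<open>gg_tail m\<close> for every \<open>m\<close>.\<close>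

definition gg_ratio :: "nat \<Rightarrow> nat \<Rightarrow> complex" where
  "gg_ratio m n = (1 - q ^ (2 * n)) / (1 - q ^ (2 * (m + n)))"

definition gg_weight :: "nat \<Rightarrow> nat \<Rightarrow> complex" where
  "gg_weight m n = (- (q ^ (4 * m + 3))) ^ n * (q ^ 8) ^ (n choose 2) * gg_coeff n"

text \<open>The \<open>n\<close>-th term of the series that Watson's transformation of very-well-poised series associates
  with the Goellnitz-Gordon series. The usual form of the last factors is
  \<open>(1 - x q^(4n)) / (1 - x q^(2n))\<close> with \<open>x = q^(2m)\<close>; it is written here as
  \<open>1 + x q^(2n) (1 - q^(2n)) / (1 - x q^(2n))\<close>, which keeps its meaning at \<open>x = 1\<close>, \<open>n = 0\<close>.\<close>

definition gg_theta_term :: "nat \<Rightarrow> nat \<Rightarrow> complex" where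
  "gg_theta_term m n = gg_weight m n * gg_tail (m + n) * (1 + q ^ (2 * (m + n)) * gg_ratio m n)"

text \<open>The telescoping certificate for the q-difference equation of \<open>\<Sum>n. gg_theta_term m n\<close>. The quadratic
  polynomial in \<open>q^(2n)\<close> is the solution of the linear system that results from comparing
  coefficients; the factor \<open>gg_ratio\<close> makes the certificate vanish at \<open>n = 0\<close>.\<close>

definition gg_cert :: "nat \<Rightarrow> nat \<Rightarrow> complex" where
  "gg_cert m n = gg_weight m n * gg_ratio m n * gg_tail (Suc (m + n))
     * (- 1 - (1 + q ^ (2 * m + 1)) * q ^ (2 * n) + q ^ (2 * m) * (q ^ (2 * n)) ^ 2)
     / (1 - q ^ (2 * (m + n) + 2))"

lemma gg_coeff_bounded: obtains C where "C > 0" "\<And>n. norm (gg_coeff n) \<le> C"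
proof -
  have "gg_coeff \<longlonglongrightarrow> qpoch_inf (- q) (q ^ 2) / qpoch_inf (q ^ 2) (q ^ 2)"
    unfolding gg_coeff_def
    by (intro tendsto_intros qpoch_tendsto qpoch_inf_nonzero norm_power_q_less_1) simp_all
  then show ?thesis using convergent_imp_norm_bounded that by metis
qed

lemma gg_ratio_bound: "norm (gg_ratio m n) \<le> 2 / (1 - norm q)"
proof (cases "m + n = 0")
  case False
  have "norm (1 - q ^ (2 * n)) \<le> 1 + 1"
    by (rule order_trans[OF norm_triangle_ineq4]) (use norm_power_q_le_1 in auto)
  then have "norm (1 - q ^ (2 * n)) / norm (1 - q ^ (2 * (m + n))) \<le> 2 / (1 - norm q)"
    using norm_one_minus_power_q_ge[of "2 * (m + n)"] False q by (intro frac_le) auto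
  then show ?thesis by (simp add: gg_ratio_def norm_divide)
qed (use q in \<open>auto simp: gg_ratio_def\<close>)

lemma gg_theta_term_0: "gg_theta_term m 0 = gg_tail m"
  by (simp add: gg_theta_term_def gg_weight_def gg_ratio_def binomial_eq_0)

lemma gg_weight_bound:
  obtains C where "C > 0"
    "\<And>m n. norm (gg_weight m n) \<le> norm (q ^ (4 * m + 3)) ^ n * norm (q ^ 8) ^ (n choose 2) * C"
proof -
  obtain C where C: "C > 0" "\<And>n. norm (gg_coeff n) \<le> C" using gg_coeff_bounded by metis
  show ?thesis
  proof (rule that[OF C(1)])
    show "norm (gg_weight m n) \<le> norm (q ^ (4 * m + 3)) ^ n * norm (q ^ 8) ^ (n choose 2) * C" for m n
      unfolding gg_weight_def norm_mult norm_power[of "- _"] norm_power[of _ "_ choose _"] norm_minus_cancel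
      by (intro mult_left_mono C) auto
  qed
qed

lemma gg_theta_term_bound:
  obtains C where "C > 0"
    "\<And>m n. norm (gg_theta_term m n) \<le> norm (q ^ (4 * m + 3)) ^ n * norm (q ^ 8) ^ (n choose 2) * C"
proof -
  obtain C where C: "C > 0"
    "\<And>m n. norm (gg_weight m n) \<le> norm (q ^ (4 * m + 3)) ^ n * norm (q ^ 8) ^ (n choose 2) * C"
    using gg_weight_bound by metis
  obtain W where W: "W > 0" "\<And>n. norm (gg_tail n) \<le> W"
    using convergent_imp_norm_bounded[OF gg_tail_tendsto] by metis
  define R where "R = 1 + 1 * (2 / (1 - norm q))"
  have R: "norm (1 + q ^ (2 * (m + n)) * gg_ratio m n) \<le> R" for m n
    unfolding R_def
    by (rule order_trans[OF norm_triangle_ineq], unfold norm_mult norm_one,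
        intro add_left_mono mult_mono norm_power_q_le_1 gg_ratio_bound) auto
  have Rp: "R > 0" using q by (simp add: R_def add_pos_nonneg)
  show ?thesis
  proof (rule that[of "C * W * R"])
    show "C * W * R > 0" using C W Rp by simp
    fix m n
    have "norm (gg_theta_term m n) \<le> (norm (q ^ (4 * m + 3)) ^ n * norm (q ^ 8) ^ (n choose 2) * C) * W * R"
      unfolding gg_theta_term_def norm_mult
      using C W by (intro mult_mono C W R) (auto intro!: mult_nonneg_nonneg simp: less_imp_le)
    then show "norm (gg_theta_term m n) \<le> norm (q ^ (4 * m + 3)) ^ n * norm (q ^ 8) ^ (n choose 2) * (C * W * R)"
      by (simp only: mult_ac)
  qed
qed

lemma summable_gg_theta_term: "summable (gg_theta_term m)"
proof -
  obtain C where C: "C > 0"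
    "\<And>m n. norm (gg_theta_term m n) \<le> norm (q ^ (4 * m + 3)) ^ n * norm (q ^ 8) ^ (n choose 2) * C"
    using gg_theta_term_bound by metis
  show ?thesis
    by (rule summable_comparison_test'[OF summable_mult2[OF summable_theta[OF norm_ge_zero norm_ge_zero]] C(2)])
       (rule norm_power_q_less_1, simp)
qed

lemma gg_cert_tendsto_0: "gg_cert m \<longlonglongrightarrow> 0"
proof -
  obtain C where C: "C > 0"
    "\<And>m n. norm (gg_weight m n) \<le> norm (q ^ (4 * m + 3)) ^ n * norm (q ^ 8) ^ (n choose 2) * C"
    using gg_weight_bound by metis
  have "summable (\<lambda>n. norm (q ^ (4 * m + 3)) ^ n * norm (q ^ 8) ^ (n choose 2) * C)"
    using norm_power_q_less_1[of 8] by (intro summable_mult2 summable_theta) auto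
  then have 0: "gg_weight m \<longlonglongrightarrow> 0"
    by (rule Lim_null_comparison[OF _ summable_LIMSEQ_zero, rotated]) (auto intro!: C always_eventually)
  have pw: "(\<lambda>n. q ^ (2 * n)) \<longlonglongrightarrow> 0"
    unfolding power_mult by (intro LIMSEQ_power_zero norm_power_q_less_1) simp
  have pw2: "(\<lambda>n. q ^ (2 * (m + n))) \<longlonglongrightarrow> 0"
    using LIMSEQ_ignore_initial_segment[OF pw, of m] by (simp add: add.commute)
  have r: "(\<lambda>n. gg_ratio m n) \<longlonglongrightarrow> (1 - 0) / (1 - 0)"
    unfolding gg_ratio_def by (intro tendsto_intros pw pw2) simp
  have t: "(\<lambda>n. gg_tail (Suc (m + n))) \<longlonglongrightarrow> 1"
    using LIMSEQ_ignore_initial_segment[OF gg_tail_tendsto, of "Suc m"] by (simp add: add_ac)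
  have "(\<lambda>n. gg_cert m n) \<longlonglongrightarrow> 0 * ((1 - 0) / (1 - 0)) * 1 *
     (- 1 - (1 + q ^ (2 * m + 1)) * 0 + q ^ (2 * m) * 0 ^ 2) / (1 - 0 * q ^ 2)"
    unfolding gg_cert_def power_add[of q "2 * (m + _)" 2]
    by (intro tendsto_intros 0 r t pw pw2) simp
  then show ?thesis by simp
qed

text \<open>Every factor is expressed through \<open>gg_weight m n\<close> and \<open>gg_tail (m + n + 2)\<close>; what is left is
  a rational identity in \<open>q^(2m)\<close>, \<open>q^(2n)\<close> and \<open>q\<close>.\<close>

lemma gg_theta_term_telescopes:
  "gg_theta_term m n - (1 + q ^ (2 * m + 1)) * gg_theta_term (Suc m) n
      - q ^ (2 * m + 2) * gg_theta_term (Suc (Suc m)) n = gg_cert m (Suc n) - gg_cert m n"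
proof -
  define x where "x = q ^ (2 * m)"
  define y where "y = q ^ (2 * n)"
  define c where "c = gg_weight m n"
  define r where "r = gg_ratio m n"
  define V where "V = gg_tail (Suc (Suc (m + n)))"
  define A where "A = 1 - x * y * q ^ 2"
  define B where "B = 1 - x * y * q ^ 4"
  have xy: "q ^ (2 * (m + n)) = x * y"
    by (simp add: x_def y_def power_add)
  have e2: "q ^ (2 * (Suc m + n)) = x * y * q ^ 2" "q ^ (2 * (m + Suc n)) = x * y * q ^ 2"
      "q ^ (2 * (Suc (Suc m) + n)) = x * y * q ^ 4" "q ^ (2 * (m + n) + 2) = x * y * q ^ 2"
      "q ^ (2 * (m + Suc n) + 2) = x * y * q ^ 4" "q ^ (2 * Suc n) = q ^ 2 * y"
      "q ^ (2 * m + 1) = x * q" "q ^ (2 * m + 2) = x * q ^ 2"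
    by (simp_all add: x_def y_def power_add mult_ac distrib_left power2_eq_square power4_eq_xxxx)
  have nz: "A \<noteq> 0" "B \<noteq> 0" "1 - q ^ 2 * y \<noteq> 0"
    unfolding A_def B_def e2(4-6)[symmetric] by (rule one_minus_power_q_nonzero; simp)+
  have r: "r * (1 - x * y) = 1 - y"
  proof (cases "m + n = 0")
    case False
    have "1 - x * y \<noteq> 0"
      using one_minus_power_q_nonzero[of "2 * (m + n)"] False unfolding xy by simp
    moreover have "r = (1 - y) / (1 - x * y)"
      unfolding r_def gg_ratio_def xy unfolding y_def ..
    ultimately show ?thesis by simp
  qed (simp add: x_def y_def)
  have t1: "gg_tail (Suc (m + n)) = (1 + x * y * q ^ 3) * V / B"
  proof -
    have "gg_tail (Suc (m + n)) * B = (1 + x * y * q ^ 3) * V"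
      using gg_tail_Suc[of "Suc (m + n)"]
      by (simp add: B_def V_def x_def y_def power_add mult_ac distrib_left eval_nat_numeral)
    then show ?thesis using nz by (simp add: field_simps)
  qed
  have t0: "gg_tail (m + n) = (1 + x * y * q) * ((1 + x * y * q ^ 3) * V / B) / A"
  proof -
    have "gg_tail (m + n) * A = (1 + x * y * q) * gg_tail (Suc (m + n))"
      using gg_tail_Suc[of "m + n"]
      by (simp add: A_def x_def y_def power_add mult_ac distrib_left eval_nat_numeral)
    then show ?thesis using nz unfolding t1 by (simp add: field_simps)
  qed
  have w1: "gg_weight (Suc m) n = c * y ^ 2"
  proof -
    have "- (q ^ (4 * Suc m + 3)) = - (q ^ (4 * m + 3)) * q ^ 4"
      by (simp add: power_add eval_nat_numeral)
    moreover have "(q ^ 4) ^ n = y ^ 2"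
      by (simp add: y_def flip: power_mult)
    ultimately show ?thesis
      unfolding c_def gg_weight_def by (simp only: power_mult_distrib mult_ac)
  qed
  have w2: "gg_weight (Suc (Suc m)) n = c * y ^ 4"
  proof -
    have "- (q ^ (4 * Suc (Suc m) + 3)) = - (q ^ (4 * m + 3)) * q ^ 8"
      by (simp add: power_add eval_nat_numeral)
    moreover have "(q ^ 8) ^ n = y ^ 4"
      by (simp add: y_def flip: power_mult)
    ultimately show ?thesis
      unfolding c_def gg_weight_def by (simp only: power_mult_distrib mult_ac)
  qed
  have wS: "gg_weight m (Suc n) * (1 - q ^ 2 * y) = - c * (x ^ 2 * y ^ 4 * q ^ 3 * (1 + q * y))"
  proof -
    have c': "gg_coeff (Suc n) * (1 - q ^ 2 * y) = gg_coeff n * (1 + q * y)"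
      using gg_coeff_Suc[of n] by (simp add: y_def power_add mult_ac power2_eq_square)
    have "(q ^ 8) ^ (Suc n choose 2) = (q ^ 8) ^ n * (q ^ 8) ^ (n choose 2)"
      unfolding choose_two_Suc power_add ..
    also have "(q ^ 8) ^ n = y ^ 4"
      by (simp add: y_def flip: power_mult)
    finally have p: "(q ^ 8) ^ (Suc n choose 2) = y ^ 4 * (q ^ 8) ^ (n choose 2)" .
    have "q ^ (4 * m + 3) = x ^ 2 * q ^ 3"
      by (simp add: x_def power_add flip: power_mult)
    then have s: "(- (q ^ (4 * m + 3))) ^ Suc n = - (x ^ 2 * q ^ 3) * (- (q ^ (4 * m + 3))) ^ n"
      by (simp only: power_Suc)
    have "gg_weight m (Suc n) * (1 - q ^ 2 * y) =
        (- (q ^ (4 * m + 3))) ^ Suc n * (q ^ 8) ^ (Suc n choose 2) * (gg_coeff (Suc n) * (1 - q ^ 2 * y))"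
      unfolding gg_weight_def by (simp only: mult_ac)
    also have "\<dots> = - c * (x ^ 2 * y ^ 4 * q ^ 3 * (1 + q * y))"
      unfolding c' p s c_def gg_weight_def by (simp only: mult_ac mult_minus_left mult_minus_right)
    finally show ?thesis .
  qed
  have r1: "gg_ratio (Suc m) n = (1 - y) / A" "gg_ratio (Suc (Suc m)) n = (1 - y) / B"
      "gg_ratio m (Suc n) = (1 - q ^ 2 * y) / A"
    unfolding gg_ratio_def e2 A_def B_def by (simp_all add: y_def)
  define h where "h = - 1 - (1 + x * q) * y + x * y ^ 2"
  define h' where "h' = - 1 - (1 + x * q) * (q ^ 2 * y) + x * (q ^ 2 * y) ^ 2"
  define D where "D = 1 + x * y * q ^ 3"
  have T0: "gg_theta_term m n = c * V / (A * B) * ((1 + x * y * q) * D * (1 + x * y * r))"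
    unfolding gg_theta_term_def t0 xy D_def by (simp add: c_def r_def mult_ac)
  have T1: "gg_theta_term (Suc m) n = c * V / (A * B) * (y ^ 2 * D * (A + x * q ^ 2 * y * (1 - y)))"
    unfolding gg_theta_term_def w1 r1 e2 unfolding add_Suc t1 D_def[symmetric] using nz by (simp add: field_simps)
  have T2: "gg_theta_term (Suc (Suc m)) n = c * V / (A * B) * (y ^ 4 * A * (B + x * q ^ 4 * y * (1 - y)))"
    unfolding gg_theta_term_def w2 r1 e2 unfolding add_Suc V_def[symmetric] using nz by (simp add: field_simps)
  have G0: "gg_cert m n = c * V / (A * B) * (r * D * h)"
    unfolding gg_cert_def e2 t1 D_def[symmetric] A_def[symmetric] y_def[symmetric] x_def[symmetric]
      c_def[symmetric] r_def[symmetric] h_def[symmetric] by (simp add: mult_ac)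
  have G1: "gg_cert m (Suc n) = c * V / (A * B) * (- (x ^ 2 * y ^ 4 * q ^ 3 * (1 + q * y)) * h')"
  proof -
    have "gg_cert m (Suc n) = (gg_weight m (Suc n) * (1 - q ^ 2 * y)) * V * h' / (A * B)"
      unfolding gg_cert_def r1 e2 unfolding add_Suc_right V_def[symmetric] B_def[symmetric] x_def[symmetric] h'_def[symmetric]
      by simp
    then show ?thesis unfolding wS by simp
  qed
  have "c * V / (A * B) * ((1 + x * y * q) * D * (1 + x * y * r)
       - (1 + x * q) * y ^ 2 * D * (A + x * q ^ 2 * y * (1 - y))
       - x * q ^ 2 * y ^ 4 * A * (B + x * q ^ 4 * y * (1 - y)))
     = c * V / (A * B) * (- (x ^ 2 * y ^ 4 * q ^ 3 * (1 + q * y)) * h' - r * D * h)"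
    using gg_polynomial_identity[OF r, of q]
    unfolding h_def[symmetric] h'_def[symmetric] D_def[symmetric] A_def[symmetric] B_def[symmetric]
    by (simp only:)
  then show ?thesis
    unfolding T0 T1 T2 G0 G1 e2 by (simp only: right_diff_distrib mult_ac)
qed

lemma gg_theta_recurrence:
  "suminf (gg_theta_term m) = (1 + q ^ (2 * m + 1)) * suminf (gg_theta_term (Suc m))
     + q ^ (2 * m + 2) * suminf (gg_theta_term (Suc (Suc m)))"
proof -
  have "(\<lambda>n. gg_theta_term m n - (1 + q ^ (2 * m + 1)) * gg_theta_term (Suc m) n
      - q ^ (2 * m + 2) * gg_theta_term (Suc (Suc m)) n) sums
     (suminf (gg_theta_term m) - (1 + q ^ (2 * m + 1)) * suminf (gg_theta_term (Suc m))
     - q ^ (2 * m + 2) * suminf (gg_theta_term (Suc (Suc m))))"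
    by (intro sums_diff sums_mult summable_sums summable_gg_theta_term)
  moreover have "(\<lambda>n. gg_theta_term m n - (1 + q ^ (2 * m + 1)) * gg_theta_term (Suc m) n
      - q ^ (2 * m + 2) * gg_theta_term (Suc (Suc m)) n) sums (0 - gg_cert m 0)"
    unfolding gg_theta_term_telescopes by (rule telescope_sums[OF gg_cert_tendsto_0])
  moreover have "gg_cert m 0 = 0"
    by (simp add: gg_cert_def gg_ratio_def)
  ultimately show ?thesis
    using sums_unique2 by (fastforce simp: algebra_simps)
qed

lemma gg_theta_tendsto: "(\<lambda>m. suminf (gg_theta_term m)) \<longlonglongrightarrow> 1"
proof -
  obtain C where C: "C > 0"
    "\<And>m n. norm (gg_theta_term m n) \<le> norm (q ^ (4 * m + 3)) ^ n * norm (q ^ 8) ^ (n choose 2) * C"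
    using gg_theta_term_bound by metis
  have lim: "(\<lambda>m. gg_theta_term m n) \<longlonglongrightarrow> (if n = 0 then 1 else 0)" for n
  proof (cases "n = 0")
    case True
    then show ?thesis using gg_tail_tendsto by (simp add: gg_theta_term_0)
  next
    case False
    have "(\<lambda>m. norm ((q ^ 4) ^ m * q ^ 3) ^ n * norm (q ^ 8) ^ (n choose 2) * C) \<longlonglongrightarrow>
        norm (0 * q ^ 3) ^ n * norm (q ^ 8) ^ (n choose 2) * C"
      by (intro tendsto_intros LIMSEQ_power_zero norm_power_q_less_1) simp
    then have "(\<lambda>m. norm (q ^ (4 * m + 3)) ^ n * norm (q ^ 8) ^ (n choose 2) * C) \<longlonglongrightarrow> 0"
      using False by (simp add: power_mult power_add zero_power)
    then have "(\<lambda>m. gg_theta_term m n) \<longlonglongrightarrow> 0"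
      by (rule Lim_null_comparison[OF always_eventually, rotated]) (auto intro: C)
    then show ?thesis using False by simp
  qed
  have bound: "norm (gg_theta_term m n) \<le> 1 ^ n * norm (q ^ 8) ^ (n choose 2) * C" for m n
  proof -
    have "norm (q ^ (4 * m + 3)) ^ n \<le> 1 ^ n"
      by (intro power_mono norm_power_q_le_1) simp
    then show ?thesis
      using C(1) by (intro order_trans[OF C(2)] mult_right_mono) auto
  qed
  have "summable (\<lambda>n. 1 ^ n * norm (q ^ 8) ^ (n choose 2) * C)"
    using norm_power_q_less_1[of 8] by (intro summable_mult2 summable_theta) auto
  from tannery_sequentially(1)[OF lim bound this] show ?thesis
    unfolding suminf_indicator_0 .
qed

lemma summable_gg_term: "summable (gg_term m)"
proof -
  obtain C where "\<And>n. norm (gg_coeff n) \<le> C" using gg_coeff_bounded by metis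
  then show ?thesis
    unfolding gg_term_def by (intro theta_summable norm_power_q_less_1) simp_all
qed

text \<open>With \<open>F(x)\<close> for the series, \<open>F(x) - F(x q^2)\<close> multiplies the \<open>n\<close>-th coefficient by
  \<open>1 - q^(2n)\<close>, which cancels the last factor of its denominator. Hence
  \<open>F(x) = (1 + x q) F(x q^2) + x q^2 F(x q^4)\<close>.\<close>

lemma gg_term_recurrence:
  "suminf (gg_term m) = (1 + q ^ (2 * m + 1)) * suminf (gg_term (Suc m))
     + q ^ (2 * m + 2) * suminf (gg_term (Suc (Suc m)))"
proof -
  have shift: "gg_term m (Suc n) - gg_term (Suc m) (Suc n) =
      q ^ (2 * m + 1) * gg_term (Suc m) n + q ^ (2 * m + 2) * gg_term (Suc (Suc m)) n" for n
  proof -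
    define u where "u = q ^ (2 * m + 1)"
    define y where "y = q ^ (2 * n)"
    define P where "P = u ^ n * (q ^ 2) ^ (n choose 2)"
    have u1: "q ^ (2 * Suc m + 1) = u * q ^ 2" "q ^ (2 * Suc (Suc m) + 1) = u * q ^ 4" "q ^ (2 * m + 2) = u * q"
      by (simp_all add: u_def power_add eval_nat_numeral)
    have y: "(q ^ 2) ^ n = y" "(q ^ 4) ^ n = y ^ 2"
      by (simp_all add: y_def flip: power_mult)
    have c: "gg_coeff (Suc n) * (1 - y * q ^ 2) = gg_coeff n * (1 + y * q)"
      using gg_coeff_Suc[of n] unfolding y_def power_add by simp
    have a: "gg_term m (Suc n) = u * P * y * gg_coeff (Suc n)"
      unfolding gg_term_def u_def[symmetric] unfolding choose_two_Suc power_add y P_def by (simp add: mult_ac)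
    have b: "gg_term (Suc m) (Suc n) = u * P * y * gg_coeff (Suc n) * (y * q ^ 2)"
      unfolding gg_term_def u1 unfolding choose_two_Suc power_add power_mult_distrib y P_def
      by (simp add: mult_ac y)
    have d: "gg_term (Suc m) n = P * y * gg_coeff n" "gg_term (Suc (Suc m)) n = P * y ^ 2 * gg_coeff n"
      unfolding gg_term_def u1 power_mult_distrib y P_def by (simp_all add: mult_ac)
    have "gg_term m (Suc n) - gg_term (Suc m) (Suc n) = u * P * y * (gg_coeff (Suc n) * (1 - y * q ^ 2))"
      unfolding a b by (simp add: algebra_simps)
    also have "\<dots> = u * gg_term (Suc m) n + u * q * gg_term (Suc (Suc m)) n"
      unfolding c d by (simp add: algebra_simps power2_eq_square)
    finally show ?thesis by (simp only: u1 u_def[symmetric])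
  qed
  have "(\<lambda>n. gg_term m (Suc n) - gg_term (Suc m) (Suc n)) sums
      (q ^ (2 * m + 1) * suminf (gg_term (Suc m)) + q ^ (2 * m + 2) * suminf (gg_term (Suc (Suc m))))"
    unfolding shift by (intro sums_add sums_mult summable_sums summable_gg_term)
  then have "(\<lambda>n. gg_term m n - gg_term (Suc m) n) sums
      (q ^ (2 * m + 1) * suminf (gg_term (Suc m)) + q ^ (2 * m + 2) * suminf (gg_term (Suc (Suc m))))"
    by (subst (asm) sums_Suc_iff) (simp add: gg_term_def)
  moreover have "(\<lambda>n. gg_term m n - gg_term (Suc m) n) sums (suminf (gg_term m) - suminf (gg_term (Suc m)))"
    by (intro sums_diff summable_sums summable_gg_term)
  ultimately show ?thesis
    using sums_unique2 by (fastforce simp: algebra_simps)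
qed

lemma gg_term_tendsto: "(\<lambda>m. suminf (gg_term m)) \<longlonglongrightarrow> 1"
proof -
  obtain C where C: "C > 0" "\<And>n. norm (gg_coeff n) \<le> C" using gg_coeff_bounded by metis
  have lim: "(\<lambda>m. gg_term m n) \<longlonglongrightarrow> (if n = 0 then 1 else 0)" for n
  proof -
    have "(\<lambda>m. ((q ^ 2) ^ m * q) ^ n * (q ^ 2) ^ (n choose 2) * gg_coeff n) \<longlonglongrightarrow>
        (0 * q) ^ n * (q ^ 2) ^ (n choose 2) * gg_coeff n"
      by (intro tendsto_intros LIMSEQ_power_zero norm_power_q_less_1) simp
    moreover have "gg_term m n = ((q ^ 2) ^ m * q) ^ n * (q ^ 2) ^ (n choose 2) * gg_coeff n" for m
      unfolding gg_term_def power_add power_mult by simp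
    ultimately show ?thesis
      by (cases "n = 0") (simp_all add: zero_power binomial_eq_0)
  qed
  have bound: "norm (gg_term m n) \<le> 1 ^ n * norm (q ^ 2) ^ (n choose 2) * C" for m n
    unfolding gg_term_def norm_mult norm_power[of _ n] norm_power[of _ "n choose 2"]
    by (intro mult_mono power_mono norm_power_q_le_1 C) auto
  have "summable (\<lambda>n. 1 ^ n * norm (q ^ 2) ^ (n choose 2) * C)"
    using norm_power_q_less_1[of 2] by (intro summable_mult2 summable_theta) auto
  from tannery_sequentially(1)[OF lim bound this] show ?thesis
    unfolding suminf_indicator_0 .
qed

lemma gg_term_eq_theta: "suminf (gg_term m) = suminf (gg_theta_term m)"
proof -
  define d where "d m = suminf (gg_term m) - suminf (gg_theta_term m)" for m
  have geo: "summable (\<lambda>m. norm (q ^ (2 * m + k)))" for k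
  proof -
    have "summable (\<lambda>m. norm (q ^ k) * norm (q ^ 2) ^ m)"
      using norm_power_q_less_1[of 2] by (intro summable_mult summable_geometric) auto
    moreover have "norm (q ^ (2 * m + k)) = norm (q ^ k) * norm (q ^ 2) ^ m" for m
      unfolding power_add power_mult[of q 2 m] norm_mult norm_power[of "q ^ 2" m] by (rule mult.commute)
    ultimately show ?thesis by (simp only:)
  qed
  have "d m = 0"
  proof (rule recurrence_zero_if_tendsto_zero[OF _ geo[of 1] geo[of 2]])
    show "d m = (1 + q ^ (2 * m + 1)) * d (Suc m) + q ^ (2 * m + 2) * d (Suc (Suc m))" for m
      unfolding d_def gg_term_recurrence[of m] gg_theta_recurrence[of m] by (simp add: algebra_simps)
    show "d \<longlonglongrightarrow> 0"
      using tendsto_diff[OF gg_term_tendsto gg_theta_tendsto] by (simp add: d_def[abs_def])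
  qed
  then show ?thesis by (simp add: d_def)
qed

lemma summable_theta_q8: "summable (\<lambda>n. (- z) ^ n * (q ^ 8) ^ (n choose 2))"
  using theta_summable[OF norm_power_q_less_1[of 8], of "\<lambda>_. 1" 1 "- z"] by simp

text \<open>At \<open>x = 1\<close> the weight and the tail of the product combine to a constant and the term with index
  \<open>n > 0\<close> keeps the factor \<open>1 + q^(2n)\<close>. Its two parts are the terms with index \<open>n\<close> and
  \<open>-n\<close> of the theta series with base \<open>q^8\<close> and \<open>z = q^3\<close>.\<close>

lemma gg_theta_sum_0:
  "suminf (gg_theta_term 0) = gg_tail 0 * (qpoch_inf (q ^ 3) (q ^ 8) * qpoch_inf (q ^ 5) (q ^ 8) * qpoch_inf (q ^ 8) (q ^ 8))"
proof -
  define g where "g n = (if n = 0 then 0 else (- (q ^ 5)) ^ n * (q ^ 8) ^ (n choose 2))" for n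
  have z: "q ^ 8 / q ^ 3 = q ^ 5"
    using q by (simp add: power_diff[symmetric])
  have eq: "gg_theta_term 0 n = gg_tail 0 * ((- (q ^ 3)) ^ n * (q ^ 8) ^ (n choose 2) + g n)" for n
  proof (cases "n = 0")
    case False
    have "(- (q ^ 5)) ^ n = (- (q ^ 3) * q ^ 2) ^ n"
      by (simp flip: power_add)
    also have "\<dots> = (- (q ^ 3)) ^ n * q ^ (2 * n)"
      by (simp only: power_mult_distrib power_mult)
    finally have 5: "(- (q ^ 5)) ^ n = (- (q ^ 3)) ^ n * q ^ (2 * n)" .
    have "gg_ratio 0 n = 1"
      using one_minus_power_q_nonzero[of "2 * n"] False by (simp add: gg_ratio_def)
    then have "gg_theta_term 0 n = (- (q ^ 3)) ^ n * (q ^ 8) ^ (n choose 2) * (gg_coeff n * gg_tail n) * (1 + q ^ (2 * n))"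
      by (simp add: gg_theta_term_def gg_weight_def)
    then show ?thesis
      using False unfolding g_def 5 gg_coeff_tail by (simp add: algebra_simps)
  qed (simp add: gg_theta_term_0 g_def binomial_eq_0)
  have sg: "summable (\<lambda>n. g (Suc n))"
    unfolding g_def using summable_ignore_initial_segment[OF summable_theta_q8[of "q ^ 5"], of 1] by simp
  then have g: "summable g" "suminf g = (\<Sum>n. g (Suc n))"
    by (simp_all add: summable_Suc_iff suminf_split_head[of g] g_def[of 0])
  have "suminf (gg_theta_term 0) = gg_tail 0 * ((\<Sum>n. (- (q ^ 3)) ^ n * (q ^ 8) ^ (n choose 2)) + suminf g)"
    unfolding eq suminf_add[OF summable_theta_q8 g(1)]
    by (rule suminf_mult[OF summable_add[OF summable_theta_q8 g(1)]])
  also have "suminf g = (\<Sum>n. (- (q ^ 8 / q ^ 3)) ^ Suc n * (q ^ 8) ^ (Suc n choose 2))"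
    unfolding g(2) z by (simp add: g_def)
  also have "(\<Sum>n. (- (q ^ 3)) ^ n * (q ^ 8) ^ (n choose 2)) + \<dots> =
      qpoch_inf (q ^ 3) (q ^ 8) * qpoch_inf (q ^ 5) (q ^ 8) * qpoch_inf (q ^ 8) (q ^ 8)"
    using q by (subst jacobi_triple_product) (simp_all add: z norm_power_q_less_1)
  finally show ?thesis .
qed

text \<open>At \<open>x = q^2\<close> the remaining factor is \<open>1 - q^(2n+1)\<close>, and its two parts are the terms with index
  \<open>n\<close> and \<open>-n-1\<close> of the theta series with base \<open>q^8\<close> and \<open>z = q^7\<close>.\<close>

lemma gg_theta_sum_1:
  "suminf (gg_theta_term 1) = gg_tail 0 * (qpoch_inf (q ^ 7) (q ^ 8) * qpoch_inf q (q ^ 8) * qpoch_inf (q ^ 8) (q ^ 8))"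
proof -
  have z: "q ^ 8 / q ^ 7 = q"
    using q by (simp add: power_diff[symmetric])
  have eq: "gg_theta_term 1 n = gg_tail 0 * ((- (q ^ 7)) ^ n * (q ^ 8) ^ (n choose 2) + (- q) ^ Suc n * (q ^ 8) ^ (Suc n choose 2))" for n
  proof -
    define y where "y = q ^ (2 * n)"
    have yn: "1 - y * q ^ 2 \<noteq> 0" "1 + y * q \<noteq> 0"
      using one_minus_power_q_nonzero[of "2 * n + 2"] one_plus_power_q_nonzero[of "2 * n"]
      by (simp_all add: y_def power_add mult_ac power2_eq_square)
    have "(- q) ^ n * (q ^ 8) ^ n = (- (q ^ 7) * q ^ 2) ^ n"
      by (simp flip: power_mult_distrib power_add) (simp add: eval_nat_numeral)
    also have "\<dots> = (- (q ^ 7)) ^ n * y"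
      by (simp only: power_mult_distrib y_def power_mult)
    finally have "(- q) ^ Suc n * (q ^ 8) ^ (Suc n choose 2) = - q * ((- (q ^ 7)) ^ n * y) * (q ^ 8) ^ (n choose 2)"
      unfolding choose_two_Suc power_add by (simp add: mult_ac)
    then have 1: "(- (q ^ 7)) ^ n * (q ^ 8) ^ (n choose 2) + (- q) ^ Suc n * (q ^ 8) ^ (Suc n choose 2)
        = (- (q ^ 7)) ^ n * (q ^ 8) ^ (n choose 2) * (1 - y * q)"
      by (simp only:) (simp add: algebra_simps)
    have "gg_tail n * (1 - y * q ^ 2) = (1 + y * q) * gg_tail (Suc n)"
      using gg_tail_Suc[of n] unfolding y_def power_add by simp
    then have 2: "gg_tail (Suc n) = gg_tail n * (1 - y * q ^ 2) / (1 + y * q)"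
      using yn by (simp add: field_simps)
    have 3: "gg_ratio 1 n = (1 - y) / (1 - y * q ^ 2)"
      by (simp add: gg_ratio_def y_def power_add power2_eq_square mult_ac)
    have "(1 - y * q ^ 2) / (1 + y * q) * (1 + y * q ^ 2 * ((1 - y) / (1 - y * q ^ 2))) = 1 - y * q"
      using yn by (simp add: divide_simps) (simp add: algebra_simps power2_eq_square)
    then have 4: "gg_tail (Suc n) * (1 + y * q ^ 2 * gg_ratio 1 n) = gg_tail n * (1 - y * q)"
      unfolding 2 3 by (metis mult.assoc times_divide_eq_right)
    have y2: "q ^ (2 * (1 + n)) = y * q ^ 2"
      by (simp add: y_def power_add power2_eq_square mult_ac)
    have w: "gg_weight 1 n = (- (q ^ 7)) ^ n * (q ^ 8) ^ (n choose 2) * gg_coeff n"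
      by (simp add: gg_weight_def)
    have "gg_theta_term 1 n = (- (q ^ 7)) ^ n * (q ^ 8) ^ (n choose 2) * gg_coeff n *
        (gg_tail (Suc n) * (1 + y * q ^ 2 * gg_ratio 1 n))"
      unfolding gg_theta_term_def y2 w by simp
    also have "\<dots> = (gg_coeff n * gg_tail n) * ((- (q ^ 7)) ^ n * (q ^ 8) ^ (n choose 2) * (1 - y * q))"
      unfolding 4 by (simp only: mult_ac)
    finally show ?thesis unfolding 1 gg_coeff_tail .
  qed
  have s: "summable (\<lambda>n. (- q) ^ Suc n * (q ^ 8) ^ (Suc n choose 2))"
    using summable_ignore_initial_segment[OF summable_theta_q8[of q], of 1] by simp
  have "suminf (gg_theta_term 1) = gg_tail 0 * ((\<Sum>n. (- (q ^ 7)) ^ n * (q ^ 8) ^ (n choose 2))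
     + (\<Sum>n. (- q) ^ Suc n * (q ^ 8) ^ (Suc n choose 2)))"
    unfolding eq suminf_add[OF summable_theta_q8 s]
    by (rule suminf_mult[OF summable_add[OF summable_theta_q8 s]])
  also have "(\<Sum>n. (- (q ^ 7)) ^ n * (q ^ 8) ^ (n choose 2)) + (\<Sum>n. (- q) ^ Suc n * (q ^ 8) ^ (Suc n choose 2))
     = qpoch_inf (q ^ 7) (q ^ 8) * qpoch_inf q (q ^ 8) * qpoch_inf (q ^ 8) (q ^ 8)"
    using jacobi_triple_product[OF norm_power_q_less_1[of 8], of "q ^ 7"] q unfolding z by simp
  finally show ?thesis .
qed

text \<open>The products \<open>(q^r; q^8)\<close> with odd \<open>r\<close> assemble to \<open>(q; q^2)\<close>, which together with
  \<open>(-q; q^2)\<close> gives \<open>(q^2; q^4)\<close>; those with \<open>r = 4, 8\<close> assemble to \<open>(q^4; q^4)\<close>. In total this is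
  \<open>(q^2; q^2)\<close>, the denominator of \<open>gg_tail 0\<close>.\<close>

lemma gg_product:
  "gg_tail 0 * (qpoch_inf q (q ^ 8) * qpoch_inf (q ^ 3) (q ^ 8) * qpoch_inf (q ^ 4) (q ^ 8) *
     qpoch_inf (q ^ 5) (q ^ 8) * qpoch_inf (q ^ 7) (q ^ 8) * qpoch_inf (q ^ 8) (q ^ 8)) = 1"
proof -
  \<comment> \<open>Two successive even-odd splittings, into the residue classes modulo 8.\<close>
  have "qpoch_inf q (q ^ 2) = qpoch_inf q (q ^ 8) * qpoch_inf (q ^ 5) (q ^ 8) * (qpoch_inf (q ^ 3) (q ^ 8) * qpoch_inf (q ^ 7) (q ^ 8))"
    using qpoch_inf_even_odd[OF norm_power_q_less_1[of 2], of q]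
      qpoch_inf_even_odd[OF norm_power_q_less_1[of 4], of q]
      qpoch_inf_even_odd[OF norm_power_q_less_1[of 4], of "q ^ 3"]
    by (simp flip: power_mult power_add power_Suc)
  moreover have "qpoch_inf (q ^ 4) (q ^ 4) = qpoch_inf (q ^ 4) (q ^ 8) * qpoch_inf (q ^ 8) (q ^ 8)"
    using qpoch_inf_even_odd[OF norm_power_q_less_1[of 4], of "q ^ 4"] by (simp flip: power_mult power_add)
  moreover have "qpoch_inf (q ^ 2) (q ^ 2) = qpoch_inf (q ^ 2) (q ^ 4) * qpoch_inf (q ^ 4) (q ^ 4)"
    using qpoch_inf_even_odd[OF norm_power_q_less_1[of 2], of "q ^ 2"] by (simp flip: power_mult power_add)
  moreover have "qpoch_inf q (q ^ 2) * qpoch_inf (- q) (q ^ 2) = qpoch_inf (q ^ 2) (q ^ 4)"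
    using qpoch_inf_mult_minus[OF norm_power_q_less_1[of 2], of q] by (simp flip: power_mult)
  moreover have "qpoch_inf (q ^ 2) (q ^ 2) \<noteq> 0"
    by (intro qpoch_inf_nonzero norm_power_q_less_1) simp_all
  ultimately show ?thesis
    unfolding gg_tail_def by (simp add: power2_eq_square[symmetric] field_simps)
qed

lemma gg_term_sums:
  assumes "gg_term m sums S"
  shows "(\<lambda>n. q ^ (n ^ 2 + 2 * m * n) * qpoch (- q) (q ^ 2) n / qpoch (q ^ 2) (q ^ 2) n) sums S"
proof -
  have e: "n ^ 2 + 2 * m * n = (2 * m + 1) * n + 2 * (n choose 2)" for n :: nat
    by (induction n) (simp_all add: choose_two_Suc power2_eq_square binomial_eq_0)
  have "q ^ (n ^ 2 + 2 * m * n) = (q ^ (2 * m + 1)) ^ n * (q ^ 2) ^ (n choose 2)" for n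
    unfolding e power_add[of q "_ * n"] power_mult[of q _ n] power_mult[of q 2 "n choose 2"] ..
  then show ?thesis
    using assms unfolding gg_term_def[abs_def] gg_coeff_def[abs_def] by (simp only: times_divide_eq_right)
qed

theorem goellnitz_gordon_1:
  "(\<lambda>n. q ^ (n ^ 2) * qpoch (- q) (q ^ 2) n / qpoch (q ^ 2) (q ^ 2) n) sums
     (1 / qpoch_inf_list [q, q ^ 4, q ^ 7] (q ^ 8))"
proof -
  have nz: "qpoch_inf q (q ^ 8) * (qpoch_inf (q ^ 4) (q ^ 8) * qpoch_inf (q ^ 7) (q ^ 8)) \<noteq> 0"
    using q norm_power_q_less_1 by (simp add: qpoch_inf_nonzero)
  have "gg_term 0 sums (gg_tail 0 * (qpoch_inf (q ^ 3) (q ^ 8) * qpoch_inf (q ^ 5) (q ^ 8) * qpoch_inf (q ^ 8) (q ^ 8)))"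
    using summable_sums[OF summable_gg_term] unfolding gg_theta_sum_0[symmetric] gg_term_eq_theta[symmetric] .
  also have "\<dots> = 1 / qpoch_inf_list [q, q ^ 4, q ^ 7] (q ^ 8)"
    using nz gg_product unfolding qpoch_inf_list_def by (subst eq_divide_eq) (simp add: mult_ac)
  finally show ?thesis
    using gg_term_sums[of 0] by simp
qed

theorem goellnitz_gordon_2:
  "(\<lambda>n. q ^ (n ^ 2 + 2 * n) * qpoch (- q) (q ^ 2) n / qpoch (q ^ 2) (q ^ 2) n) sums
     (1 / qpoch_inf_list [q ^ 3, q ^ 4, q ^ 5] (q ^ 8))"
proof -
  have nz: "qpoch_inf (q ^ 3) (q ^ 8) * (qpoch_inf (q ^ 4) (q ^ 8) * qpoch_inf (q ^ 5) (q ^ 8)) \<noteq> 0"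
    using q norm_power_q_less_1 by (simp add: qpoch_inf_nonzero)
  have "gg_term 1 sums (gg_tail 0 * (qpoch_inf (q ^ 7) (q ^ 8) * qpoch_inf q (q ^ 8) * qpoch_inf (q ^ 8) (q ^ 8)))"
    using summable_sums[OF summable_gg_term] unfolding gg_theta_sum_1[symmetric] gg_term_eq_theta[symmetric] .
  also have "\<dots> = 1 / qpoch_inf_list [q ^ 3, q ^ 4, q ^ 5] (q ^ 8)"
    using nz gg_product unfolding qpoch_inf_list_def by (subst eq_divide_eq) (simp add: mult_ac)
  finally show ?thesis
    using gg_term_sums[of 1] by simp
qed

end

section \<open>Reduction of the triple sums to single sums\<close>

text \<open>The inner sum over \<open>j + 2k = N - i\<close> collapses to \<open>1 / (p; p)\<^sub>N\<^sub>-\<^sub>i\<close>, and the outer sum is then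
  Rothe's.\<close>

lemma finite_triple_convolution:
  fixes p e :: complex
  assumes "norm p < 1"
  shows "(\<Sum>(i, j, k) | i + j + 2 * k = N.
            e ^ i * p ^ (i choose 2) * p ^ (j choose 2) / (qpoch p p i * qpoch p p j * qpoch (p ^ 2) (p ^ 2) k))
          = qpoch (- e) p N / qpoch p p N"
proof -
  define g where "g n m = p ^ ((n - m) choose 2) / (qpoch p p (n - m) * qpoch (p ^ 2) (p ^ 2) (m div 2))" for n m
  have "qpoch (- e) p N / qpoch p p N = (\<Sum>i\<le>N. e ^ i * p ^ (i choose 2) / qpoch p p i * (1 / qpoch p p (N - i)))"
    unfolding rothe_identity[OF assms, symmetric] by simp
  also have "\<dots> = (\<Sum>i\<le>N. \<Sum>m | m \<le> N - i \<and> even m. e ^ i * p ^ (i choose 2) / qpoch p p i * g (N - i) m)"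
    unfolding even_convolution[OF assms, symmetric] sum_distrib_left[symmetric] g_def
    by (intro sum.cong refl arg_cong2[of _ _ _ _ "(*)"] sum.mono_neutral_cong_right) auto
  also have "\<dots> = (\<Sum>(i, m) \<in> (SIGMA i:{..N}. {m. m \<le> N - i \<and> even m}).
      e ^ i * p ^ (i choose 2) / qpoch p p i * g (N - i) m)"
    by (rule sum.Sigma) auto
  also have "\<dots> = (\<Sum>(i, j, k) | i + j + 2 * k = N.
            e ^ i * p ^ (i choose 2) * p ^ (j choose 2) / (qpoch p p i * qpoch p p j * qpoch (p ^ 2) (p ^ 2) k))"
    by (rule sum.reindex_bij_witness[of _ "\<lambda>(i, j, k). (i, 2 * k)" "\<lambda>(i, m). (i, N - i - m, m div 2)"])
       (auto simp: g_def)
  finally show ?thesis ..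
qed

lemma summable_on_mult_prod:
  fixes f :: "'a \<Rightarrow> real" and g :: "'b \<Rightarrow> real"
  assumes "f summable_on A" "g summable_on B"
  shows "(\<lambda>(x, y). f x * g y) summable_on A \<times> B"
proof -
  have "(\<lambda>x. norm (f x)) summable_on A" "(\<lambda>y. norm (g y)) summable_on B"
    using assms summable_on_iff_abs_summable_on_real by blast+
  then have "(\<lambda>xy. norm (case xy of (x, y) \<Rightarrow> f x * g y)) summable_on A \<times> B"
    unfolding Infinite_Sum.abs_summable_on_Sigma_iff
    by (auto simp: abs_mult infsum_cmult_right' abs_of_nonneg infsum_nonneg
        intro!: summable_on_cmult_right summable_on_cmult_left)
  then show ?thesis
    using summable_on_iff_abs_summable_on_real by blast
qed

text \<open>Lets a geometric series in \<open>i + j + k\<close> serve as the majorant of the triple sum, whatever the sizes of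
  the parameters.\<close>

lemma gaussian_le_geometric:
  fixes r R :: real
  assumes "0 \<le> r" "r < 1" "0 \<le> R"
  obtains K where "K > 0" "\<And>N. r ^ (N ^ 2) * R ^ N \<le> K * (1 / 2) ^ N"
proof -
  have "(\<lambda>n. (2 * R) ^ n * r ^ (n choose 2)) \<longlonglongrightarrow> 0"
    using assms by (intro summable_LIMSEQ_zero summable_theta) auto
  then have "Bseq (\<lambda>n. (2 * R) ^ n * r ^ (n choose 2))"
    by (intro convergent_imp_Bseq) (auto simp: convergent_def)
  then obtain K where K: "K > 0" "\<And>n. norm ((2 * R) ^ n * r ^ (n choose 2)) \<le> K"
    by (auto simp: Bseq_def)
  show ?thesis
  proof (rule that[OF K(1)])
    fix N :: nat
    have "N choose 2 \<le> N ^ 2"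
      by (induction N) (simp_all add: choose_two_Suc power2_eq_square)
    then have "r ^ (N ^ 2) \<le> r ^ (N choose 2)"
      using assms by (intro power_decreasing) auto
    then have "r ^ (N ^ 2) * R ^ N \<le> r ^ (N choose 2) * R ^ N"
      using assms by (intro mult_right_mono) auto
    also have "\<dots> = (2 * R) ^ N * r ^ (N choose 2) * (1 / 2) ^ N"
      by (simp add: power_mult_distrib power_one_over field_simps)
    also have "\<dots> \<le> K * (1 / 2) ^ N"
      using K(2)[of N] by (intro mult_right_mono) auto
    finally show "r ^ (N ^ 2) * R ^ N \<le> K * (1 / 2) ^ N" .
  qed
qed

text \<open>The triple sum converges absolutely, so it may be summed along the finite fibres of
  \<open>(i, j, k) \<mapsto> i + j + 2k\<close>.\<close>

lemma triple_sum_eq_single_sum: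
  fixes q e b S :: complex
  assumes q: "norm q < 1"
    and S: "(\<lambda>N. q ^ (N ^ 2) * b ^ N * (qpoch (- e) (q ^ 2) N / qpoch (q ^ 2) (q ^ 2) N)) sums S"
  shows "((\<lambda>(i, j, k). q ^ ((i + j + 2 * k) ^ 2) * b ^ (i + j + 2 * k) *
            (e ^ i * (q ^ 2) ^ (i choose 2) * (q ^ 2) ^ (j choose 2) /
              (qpoch (q ^ 2) (q ^ 2) i * qpoch (q ^ 2) (q ^ 2) j * qpoch (q ^ 4) (q ^ 4) k))) has_sum S) UNIV"
    (is "(?t has_sum S) UNIV")
proof -
  have q2: "norm (q ^ 2) < 1" and q4: "norm (q ^ 4) < 1"
    using q by (simp_all add: norm_power power_less_one_iff)
  obtain C where C: "C > 0" "\<And>n. norm (inverse (qpoch (q ^ 2) (q ^ 2) n)) \<le> C"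
    using inverse_qpoch_bounded[OF q2 q2] by metis
  obtain D where D: "D > 0" "\<And>n. norm (inverse (qpoch (q ^ 4) (q ^ 4) n)) \<le> D"
    using inverse_qpoch_bounded[OF q4 q4] by metis
  define E where "E = max 1 (norm e)"
  have E: "E \<ge> 1" "norm e \<le> E" by (auto simp: E_def)
  obtain K where K: "K > 0" "\<And>N. norm q ^ (N ^ 2) * (norm b * E) ^ N \<le> K * (1 / 2) ^ N"
    by (rule gaussian_le_geometric[of "norm q" "norm b * E"]) (use q E in auto)
  define g :: "nat \<times> nat \<times> nat \<Rightarrow> real"
    where "g = (\<lambda>(i, j, k). K * (C * C * D) * (1 / 2) ^ (i + j + k))"
  have geo: "(\<lambda>n::nat. (1 / 2 :: real) ^ n) summable_on UNIV"
    by (intro norm_summable_imp_summable_on) (simp add: summable_geometric)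
  have "g = (\<lambda>x. K * (C * C * D) * (case x of (i, y) \<Rightarrow> (1 / 2) ^ i * (case y of (j, k) \<Rightarrow> (1 / 2) ^ j * (1 / 2) ^ k)))"
    by (simp add: fun_eq_iff g_def power_add)
  then have "g summable_on UNIV"
    using summable_on_cmult_right[OF summable_on_mult_prod[OF geo summable_on_mult_prod[OF geo geo]]] by simp
  then have g: "(\<lambda>x. norm (g x)) summable_on UNIV"
    using summable_on_iff_abs_summable_on_real by blast
  have bound: "norm (?t x) \<le> norm (g x)" for x
  proof -
    obtain i j k where x: "x = (i, j, k)" by (cases x)
    define N where "N = i + j + 2 * k"
    have "norm (?t x) = (norm q ^ (N ^ 2) * norm b ^ N * norm e ^ i) * (norm (q ^ 2) ^ (i choose 2) * norm (q ^ 2) ^ (j choose 2))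
        * (norm (inverse (qpoch (q ^ 2) (q ^ 2) i)) * norm (inverse (qpoch (q ^ 2) (q ^ 2) j)) * norm (inverse (qpoch (q ^ 4) (q ^ 4) k)))"
      unfolding x N_def by (simp add: norm_mult norm_divide norm_inverse norm_power divide_inverse mult_ac)
    also have "\<dots> \<le> (K * (1 / 2) ^ N) * (1 * 1) * (C * C * D)"
    proof -
      have "norm e ^ i \<le> E ^ i" using E by (intro power_mono) auto
      also have "\<dots> \<le> E ^ N" using E by (intro power_increasing) (auto simp: N_def)
      finally have "norm q ^ (N ^ 2) * norm b ^ N * norm e ^ i \<le> norm q ^ (N ^ 2) * norm b ^ N * E ^ N"
        by (intro mult_left_mono) auto
      also have "\<dots> \<le> K * (1 / 2) ^ N"
        using K(2)[of N] by (simp add: power_mult_distrib mult_ac)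
      finally have 1: "norm q ^ (N ^ 2) * norm b ^ N * norm e ^ i \<le> K * (1 / 2) ^ N" .
      have 2: "norm (q ^ 2) ^ (i choose 2) * norm (q ^ 2) ^ (j choose 2) \<le> 1 * 1"
        using q2 by (intro mult_mono power_le_one) auto
      have 3: "norm (inverse (qpoch (q ^ 2) (q ^ 2) i)) * norm (inverse (qpoch (q ^ 2) (q ^ 2) j))
          * norm (inverse (qpoch (q ^ 4) (q ^ 4) k)) \<le> C * C * D"
        using C(1) D(1) by (intro mult_mono C(2) D(2)) auto
      show ?thesis
        by (rule mult_mono[OF mult_mono[OF 1 2] 3]) (use K(1) in \<open>auto intro!: mult_nonneg_nonneg\<close>)
    qed
    also have "\<dots> = K * (C * C * D) * (1 / 2) ^ N" by simp
    also have "\<dots> \<le> K * (C * C * D) * (1 / 2) ^ (i + j + k)"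
      using C(1) D(1) K(1) by (intro mult_left_mono power_decreasing) (auto simp: N_def)
    also have "\<dots> = norm (g x)"
      using C(1) D(1) K(1) by (simp add: g_def x abs_mult)
    finally show ?thesis .
  qed
  have "(\<lambda>x. norm (?t x)) summable_on UNIV"
    by (rule Infinite_Sum.abs_summable_on_comparison_test[OF g bound])
  then have "?t summable_on UNIV" by (rule abs_summable_summable)
  then obtain s where s: "(?t has_sum s) UNIV" by (auto simp: summable_on_def)
  define F where "F N = {(i, j, k). i + j + 2 * k = N}" for N :: nat
  have inj: "inj_on snd (Sigma UNIV F)" and img: "snd ` Sigma UNIV F = UNIV"
    by (auto simp: inj_on_def F_def image_iff)
  from s have "((?t \<circ> snd) has_sum s) (Sigma UNIV F)"
    by (subst has_sum_reindex[OF inj, symmetric]) (simp only: img)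
  moreover have "((\<lambda>y. (?t \<circ> snd) (N, y)) has_sum
      (q ^ (N ^ 2) * b ^ N * (qpoch (- e) (q ^ 2) N / qpoch (q ^ 2) (q ^ 2) N))) (F N)" for N
  proof (rule has_sum_finiteI)
    have "F N \<subseteq> {..N} \<times> {..N} \<times> {..N}" by (auto simp: F_def)
    then show "finite (F N)" by (rule finite_subset) auto
    have "(q ^ 2) ^ 2 = q ^ 4" by (simp flip: power_mult)
    then show "q ^ (N ^ 2) * b ^ N * (qpoch (- e) (q ^ 2) N / qpoch (q ^ 2) (q ^ 2) N)
        = sum (\<lambda>y. (?t \<circ> snd) (N, y)) (F N)"
      unfolding finite_triple_convolution[OF q2, symmetric] F_def sum_distrib_left
      by (intro sum.cong refl) auto
  qed
  ultimately have hs: "((\<lambda>N. q ^ (N ^ 2) * b ^ N * (qpoch (- e) (q ^ 2) N / qpoch (q ^ 2) (q ^ 2) N)) has_sum s) UNIV"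
    by (rule has_sum_Sigma[OF isUCont_plus])
  then have "s = S"
    by (intro sums_unique2[OF has_sum_imp_sums[OF hs] S])
  with s show ?thesis by simp
qed

section \<open>The five identities\<close>

lemma int_choose_two: "2 * int (n choose 2) = int n ^ 2 - int n"
  by (induction n) (simp_all add: choose_two_Suc power2_eq_square algebra_simps binomial_eq_0)

text \<open>The linear terms that are reachable with \<open>e = q^s\<close> and \<open>b = q^t\<close>; the five cases of the theorem
  are \<open>(s, t) = (-2, 1), (1, 0), (0, 1), (2, 1), (1, 2)\<close>.\<close>

lemma triple_sum_powi:
  fixes q S :: complex and s t :: int
  assumes q: "norm q < 1" "q \<noteq> 0"
    and S: "(\<lambda>N. q ^ (N ^ 2) * (q powi t) ^ N *
              (qpoch (- (q powi s)) (q ^ 2) N / qpoch (q ^ 2) (q ^ 2) N)) sums S"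
  shows "((\<lambda>(i, j, k). q powi (2 * int i ^ 2 + 2 * int j ^ 2 + 4 * int k ^ 2
              + 2 * int i * int j + 4 * int i * int k + 4 * int j * int k
              + ((t + s - 1) * int i + (t - 1) * int j + 2 * t * int k))
            / (qpoch (q ^ 2) (q ^ 2) i * qpoch (q ^ 2) (q ^ 2) j * qpoch (q ^ 4) (q ^ 4) k)) has_sum S) UNIV"
proof -
  have pow: "(q powi u) ^ n = q powi (u * int n)" for u n
    by (simp add: power_int_mult)
  have pow2: "(q ^ 2) ^ n = q powi (2 * int n)" for n
    by (simp add: power_int_mult)
  have "q powi (2 * int i ^ 2 + 2 * int j ^ 2 + 4 * int k ^ 2
              + 2 * int i * int j + 4 * int i * int k + 4 * int j * int k
              + ((t + s - 1) * int i + (t - 1) * int j + 2 * t * int k))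
      = q ^ ((i + j + 2 * k) ^ 2) * (q powi t) ^ (i + j + 2 * k) *
          ((q powi s) ^ i * (q ^ 2) ^ (i choose 2) * (q ^ 2) ^ (j choose 2))" for i j k
  proof -
    have "q ^ ((i + j + 2 * k) ^ 2) * (q powi t) ^ (i + j + 2 * k) *
          ((q powi s) ^ i * (q ^ 2) ^ (i choose 2) * (q ^ 2) ^ (j choose 2))
       = q powi (int ((i + j + 2 * k) ^ 2)) * q powi (t * int (i + j + 2 * k)) *
          (q powi (s * int i) * q powi (2 * int (i choose 2)) * q powi (2 * int (j choose 2)))"
      by (simp only: pow pow2 power_int_of_nat)
    also have "\<dots> = q powi (int ((i + j + 2 * k) ^ 2) + t * int (i + j + 2 * k) +
          (s * int i + (2 * int (i choose 2)) + 2 * int (j choose 2)))"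
      by (simp only: power_int_add[OF disjI1[OF q(2)]])
    also have "int ((i + j + 2 * k) ^ 2) + t * int (i + j + 2 * k) +
          (s * int i + (2 * int (i choose 2)) + 2 * int (j choose 2)) =
          2 * int i ^ 2 + 2 * int j ^ 2 + 4 * int k ^ 2
              + 2 * int i * int j + 4 * int i * int k + 4 * int j * int k
              + ((t + s - 1) * int i + (t - 1) * int j + 2 * t * int k)"
      unfolding int_choose_two by (simp add: power2_eq_square algebra_simps)
    finally show ?thesis ..
  qed
  then show ?thesis
    using triple_sum_eq_single_sum[OF q(1) S] by (simp only: times_divide_eq_right)
qed

lemma lebesgue_series:
  fixes q a :: complex
  assumes "norm q < 1"
  shows "(\<lambda>N. q ^ (N ^ 2) * (q powi 1) ^ N * (qpoch (- a) (q ^ 2) N / qpoch (q ^ 2) (q ^ 2) N)) sums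
           (qpoch_inf (- (a * q ^ 2)) (q ^ 4) * qpoch_inf (- (q ^ 2)) (q ^ 2))"
proof -
  have q2: "norm (q ^ 2) < 1"
    using assms by (simp add: norm_power power_less_one_iff)
  have "N ^ 2 + N = 2 * (Suc N choose 2)" for N :: nat
    by (induction N) (simp_all add: choose_two_Suc power2_eq_square binomial_eq_0)
  then have "q ^ (N ^ 2) * (q powi 1) ^ N = (q ^ 2) ^ (Suc N choose 2)" for N
    by (simp flip: power_add power_mult)
  then show ?thesis
    using lebesgue_identity[OF q2, of a] by (simp flip: power_mult)
qed

theorem theorem3p11:
  fixes q :: complex
  assumes "0 < norm q" and "norm q < 1"
  shows "(((\<lambda>(i :: nat, j :: nat, k :: nat).
            q powi (2 * int i ^ 2 + 2 * int j ^ 2 + 4 * int k ^ 2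
                      + 2 * int i * int j + 4 * int i * int k + 4 * int j * int k - 2 * int i + 2 * int k)
              / (qpoch (q ^ 2) (q ^ 2) i * qpoch (q ^ 2) (q ^ 2) j * qpoch (q ^ 4) (q ^ 4) k))
          has_sum (2 * (qpoch_inf (q ^ 8) (q ^ 8) / qpoch_inf (q ^ 2) (q ^ 2)))) UNIV)
    \<and> (((\<lambda>(i :: nat, j :: nat, k :: nat).
            q powi (2 * int i ^ 2 + 2 * int j ^ 2 + 4 * int k ^ 2
                      + 2 * int i * int j + 4 * int i * int k + 4 * int j * int k - int j)
              / (qpoch (q ^ 2) (q ^ 2) i * qpoch (q ^ 2) (q ^ 2) j * qpoch (q ^ 4) (q ^ 4) k))
          has_sum (1 / qpoch_inf_list [q, q ^ 4, q ^ 7] (q ^ 8))) UNIV)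
    \<and> (((\<lambda>(i :: nat, j :: nat, k :: nat).
            q powi (2 * int i ^ 2 + 2 * int j ^ 2 + 4 * int k ^ 2
                      + 2 * int i * int j + 4 * int i * int k + 4 * int j * int k + 2 * int k)
              / (qpoch (q ^ 2) (q ^ 2) i * qpoch (q ^ 2) (q ^ 2) j * qpoch (q ^ 4) (q ^ 4) k))
          has_sum (qpoch_inf (q ^ 4) (q ^ 4) ^ 3 / (qpoch_inf (q ^ 2) (q ^ 2) ^ 2 * qpoch_inf (q ^ 8) (q ^ 8)))) UNIV)
    \<and> (((\<lambda>(i :: nat, j :: nat, k :: nat).
            q powi (2 * int i ^ 2 + 2 * int j ^ 2 + 4 * int k ^ 2
                      + 2 * int i * int j + 4 * int i * int k + 4 * int j * int k + 2 * int i + 2 * int k)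
              / (qpoch (q ^ 2) (q ^ 2) i * qpoch (q ^ 2) (q ^ 2) j * qpoch (q ^ 4) (q ^ 4) k))
          has_sum (qpoch_inf (q ^ 8) (q ^ 8) / qpoch_inf (q ^ 2) (q ^ 2))) UNIV)
    \<and> (((\<lambda>(i :: nat, j :: nat, k :: nat).
            q powi (2 * int i ^ 2 + 2 * int j ^ 2 + 4 * int k ^ 2
                      + 2 * int i * int j + 4 * int i * int k + 4 * int j * int k + 2 * int i + int j + 4 * int k)
              / (qpoch (q ^ 2) (q ^ 2) i * qpoch (q ^ 2) (q ^ 2) j * qpoch (q ^ 4) (q ^ 4) k))
          has_sum (1 / qpoch_inf_list [q ^ 3, q ^ 4, q ^ 5] (q ^ 8))) UNIV)"
proof -
  have q: "norm q < 1" "q \<noteq> 0" using assms by auto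
  have pw: "norm (q ^ n) < 1" if "n > 0" for n
    using q that by (simp add: norm_power power_less_one_iff)
  note nz = qpoch_inf_nonzero[OF pw pw]
  have nz2: "qpoch_inf (q ^ 2) (q ^ 2) \<noteq> 0" and nz4: "qpoch_inf (q ^ 4) (q ^ 4) \<noteq> 0"
    and nz8: "qpoch_inf (q ^ 8) (q ^ 8) \<noteq> 0" and nz24: "qpoch_inf (q ^ 2) (q ^ 4) \<noteq> 0"
    by (simp_all add: nz)
  \<comment> \<open>The products of Lebesgue's identity have negative parameters, those of the theorem positive ones:
      \<open>(-a; p) = (a^2; p^2) / (a; p)\<close>.\<close>
  have m2: "qpoch_inf (- (q ^ 2)) (q ^ 2) = qpoch_inf (q ^ 4) (q ^ 4) / qpoch_inf (q ^ 2) (q ^ 2)"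
    using qpoch_inf_mult_minus[OF pw[of 2], of "q ^ 2"] nz2 by (simp add: field_simps flip: power_mult)
  have m4: "qpoch_inf (- (q ^ 4)) (q ^ 4) = qpoch_inf (q ^ 8) (q ^ 8) / qpoch_inf (q ^ 4) (q ^ 4)"
    using qpoch_inf_mult_minus[OF pw[of 4], of "q ^ 4"] nz4 by (simp add: field_simps flip: power_mult)
  have d24: "qpoch_inf (q ^ 2) (q ^ 2) = qpoch_inf (q ^ 2) (q ^ 4) * qpoch_inf (q ^ 4) (q ^ 4)"
    using qpoch_inf_even_odd[OF pw[of 2], of "q ^ 2"] by (simp flip: power_mult power_add)
  have d48: "qpoch_inf (q ^ 4) (q ^ 4) = qpoch_inf (q ^ 4) (q ^ 8) * qpoch_inf (q ^ 8) (q ^ 8)"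
    using qpoch_inf_even_odd[OF pw[of 4], of "q ^ 4"] by (simp flip: power_mult power_add)
  have m24: "qpoch_inf (- (q ^ 2)) (q ^ 4) = qpoch_inf (q ^ 4) (q ^ 4) ^ 2 / (qpoch_inf (q ^ 2) (q ^ 2) * qpoch_inf (q ^ 8) (q ^ 8))"
  proof -
    have "qpoch_inf (q ^ 2) (q ^ 4) * qpoch_inf (- (q ^ 2)) (q ^ 4) = qpoch_inf (q ^ 4) (q ^ 8)"
      using qpoch_inf_mult_minus[OF pw[of 4], of "q ^ 2"] by (simp flip: power_mult)
    then show ?thesis
      using nz24 nz4 nz8 d24 d48 by (simp add: field_simps power2_eq_square)
  qed
  have m1: "qpoch_inf (- 1) (q ^ 4) = 2 * qpoch_inf (- (q ^ 4)) (q ^ 4)"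
    using qpoch_inf_rec[OF pw[of 4], of "- 1"] by simp
  have p: "q powi (- 2) = inverse (q ^ 2)" "q powi 2 = q ^ 2"
    by (simp_all add: power_int_minus)
  have S1: "qpoch_inf (- (q powi (- 2) * q ^ 2)) (q ^ 4) * qpoch_inf (- (q ^ 2)) (q ^ 2)
      = 2 * (qpoch_inf (q ^ 8) (q ^ 8) / qpoch_inf (q ^ 2) (q ^ 2))"
    using q nz4 by (simp add: p m1 m4 m2)
  have S3: "qpoch_inf (- (q powi 0 * q ^ 2)) (q ^ 4) * qpoch_inf (- (q ^ 2)) (q ^ 2)
      = qpoch_inf (q ^ 4) (q ^ 4) ^ 3 / (qpoch_inf (q ^ 2) (q ^ 2) ^ 2 * qpoch_inf (q ^ 8) (q ^ 8))"
    by (simp add: m24 m2) (simp add: power2_eq_square power3_eq_cube)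
  have S4: "qpoch_inf (- (q powi 2 * q ^ 2)) (q ^ 4) * qpoch_inf (- (q ^ 2)) (q ^ 2)
      = qpoch_inf (q ^ 8) (q ^ 8) / qpoch_inf (q ^ 2) (q ^ 2)"
    using nz4 by (simp add: p m4 m2 flip: power_add)
  have S2: "(\<lambda>N. q ^ (N ^ 2) * (q powi 0) ^ N * (qpoch (- (q powi 1)) (q ^ 2) N / qpoch (q ^ 2) (q ^ 2) N)) sums
      (1 / qpoch_inf_list [q, q ^ 4, q ^ 7] (q ^ 8))"
    using goellnitz_gordon_1[OF q] by simp
  have S5: "(\<lambda>N. q ^ (N ^ 2) * (q powi 2) ^ N * (qpoch (- (q powi 1)) (q ^ 2) N / qpoch (q ^ 2) (q ^ 2) N)) sums
      (1 / qpoch_inf_list [q ^ 3, q ^ 4, q ^ 5] (q ^ 8))"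
    using goellnitz_gordon_2[OF q] by (simp add: p power_add power_mult)
  show ?thesis
    using triple_sum_powi[OF q lebesgue_series[OF q(1), of "q powi (- 2)"]]
      triple_sum_powi[OF q S2]
      triple_sum_powi[OF q lebesgue_series[OF q(1), of "q powi 0"]]
      triple_sum_powi[OF q lebesgue_series[OF q(1), of "q powi 2"]]
      triple_sum_powi[OF q S5]
    unfolding S1 S3 S4 by (intro conjI) (simp_all add: algebra_simps)
qed

end
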